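(* Let $\mathbf X=(X,\mathcal E)$ and $\mathbf Y=(Y,\mathcal F)$ be coarse spaces, with $\mathbf X$ coarsely connected, and let $\mathcal H_{\mathbf X}$ and $\mathcal H_{\mathbf Y}$ be modules over them. Given a bounded operator $T\colon\mathcal H_{\mathbf X}\to\mathcal H_{\mathbf Y}$ and a gauge $\widetilde E\in\mathcal E$, consider: (i) $T$ is quasi-proper; (ii) ${\rm Ad}(T)(C^*_{\rm lc}(\mathcal H_{\mathbf X}))\subseteq C^*_{\rm lc}(\mathcal H_{\mathbf Y})$; (iii) ${\rm Ad}(T)({\rm Prop}(\widetilde E)\cap C^*_{\rm lc}(\mathcal H_{\mathbf X}))\subseteq C^*_{\rm lc}(\mathcal H_{\mathbf Y})$. Then (i) implies (ii), which (trivially) implies (iii). If $\mathcal H_{\mathbf X}$ is discrete, $\mathbf X$ is coarsely locally finite and $\widetilde E$ is a gauge witnessing both discreteness and local finiteness, then (iii) implies (i) as well, so that (i), (ii), (iii) are all equivalent.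
   Context: A coarse structure on a set $X$ is a family $\mathcal E$ of subsets of $X\times X$ (entourages) closed under subsets, finite unions, transposition and composition of relations, and containing the diagonal; $(X,\mathcal E)$ is a coarse space. For $E\subseteq X\times X$, $A\subseteq X$ let $E(A)=\{y\mid\exists x\in A,(y,x)\in E\}$; $A$ is $E$-bounded if $A\times A\subseteq E$, bounded if $E$-bounded for some $E\in\mathcal E$. A gauge is a symmetric entourage containing the diagonal. $\mathbf X$ is coarsely connected if every finite subset is bounded. A partition of $X$ is locally finite if each bounded set meets only finitely many of its elements. $\mathbf X$ is coarsely locally finite if for some $E\in\mathcal E$ there is a locally finite partition of $X$ into $E$-bounded sets; a gauge $\widetilde E$ witnesses (coarse) local finiteness if there is a locally finite partition of $X$ into $\widetilde E$-bounded sets. A module $\mathcal H_{\mathbf X}$ over $\mathbf X$ is a Hilbert space with a unital Boolean algebra $\mathfrak A$ of subsets of $X$ (measurable sets) and a map $A\mapsto1_A$ from $\mathfrak A$ to projections with $1_{A\cap A'}=1_A1_{A'}$, $1_{A\sqcup A'}=1_A+1_{A'}$ for disjoint sets, $1_X=\mathrm{id}$, and such that for some gauge the subspaces $1_A(\mathcal H_{\mathbf X})$, with $A$ measurable and bounded with respect to that gauge, span a dense subspace. A discrete partition is a partition $X=\bigsqcup_iC_i$ into measurable sets that are $E$-bounded for one $E\in\mathcal E$, with $\sum_i1_{C_i}=1$ strongly and such that $C\subseteq X$ is measurable whenever all $C\cap C_i$ are; the module is discrete if a discrete partition exists, and a gauge $\widetilde E$ witnesses discreteness if there is a discrete partition into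 $\widetilde E$-bounded sets. Modules over $\mathbf Y$ are defined in the same way. $C^*_{\rm lc}(\mathcal H_{\mathbf X})$ is the set of locally compact operators: $t\in\mathcal B(\mathcal H_{\mathbf X})$ with $t1_A$, $1_At$ compact for all bounded measurable $A$; similarly for $\mathcal H_{\mathbf Y}$. ${\rm Prop}(\widetilde E)$ is the set of $t\in\mathcal B(\mathcal H_{\mathbf X})$ with $1_{A'}t1_A=0$ for all measurable $A,A'$ with $A'\cap\widetilde E(A)=\emptyset$. ${\rm Ad}(T)(t)=TtT^*$. $T$ is quasi-proper if for every bounded measurable $B\subseteq Y$ and $\varepsilon>0$ there is a bounded measurable $A\subseteq X$ with $\|1_BT1_{X\smallsetminus A}\|\le\varepsilon$. *)

theory Defs
  imports "HOL-Analysis.Analysis"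
begin

section \<open>Complex Hilbert spaces and bounded operators\<close>

text \<open>
  The library only has real inner product spaces. A complex Hilbert space is a complete
  real inner product space with a compatible complex structure; the sesquilinear form is
  antilinear in its first argument, and its real part is the underlying real inner product, so
  the norm is the usual one.
\<close>

class complex_hilbert_space = real_inner + complete_space +
  fixes scaleC :: "complex \<Rightarrow> 'a \<Rightarrow> 'a"
    and cinner :: "'a \<Rightarrow> 'a \<Rightarrow> complex"
  assumes scaleC_add_right: "scaleC a (x + y) = scaleC a x + scaleC a y"
    and scaleC_add_left: "scaleC (a + b) x = scaleC a x + scaleC b x"
    and scaleC_scaleC: "scaleC a (scaleC b x) = scaleC (a * b) x"
    and scaleC_one: "scaleC 1 x = x"
    and scaleR_scaleC: "scaleR r x = scaleC (complex_of_real r) x"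
    and cinner_commute: "cinner x y = cnj (cinner y x)"
    and cinner_add_left: "cinner (x + y) z = cinner x z + cinner y z"
    and cinner_scaleC_left: "cinner (scaleC a x) y = cnj a * cinner x y"
    and inner_cinner: "inner x y = Re (cinner x y)"

definition bounded_clinear ::
    "('a::complex_hilbert_space \<Rightarrow> 'b::complex_hilbert_space) \<Rightarrow> bool" where
  "bounded_clinear f \<longleftrightarrow> bounded_linear f \<and> (\<forall>a x. f (scaleC a x) = scaleC a (f x))"

definition cadjoint ::
    "('a::complex_hilbert_space \<Rightarrow> 'b::complex_hilbert_space) \<Rightarrow> 'b \<Rightarrow> 'a" where
  "cadjoint T = (THE S. \<forall>x y. cinner (T x) y = cinner x (S y))"

definition orth_projection :: "('a::complex_hilbert_space \<Rightarrow> 'a) \<Rightarrow> bool" where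
  "orth_projection p \<longleftrightarrow>
     bounded_clinear p \<and> p \<circ> p = p \<and> (\<forall>x y. cinner (p x) y = cinner x (p y))"

definition compact_op ::
    "('a::complex_hilbert_space \<Rightarrow> 'b::complex_hilbert_space) \<Rightarrow> bool" where
  "compact_op f \<longleftrightarrow> bounded_clinear f \<and> compact (closure (f ` cball 0 1))"

definition Ad ::
    "('a::complex_hilbert_space \<Rightarrow> 'b::complex_hilbert_space) \<Rightarrow> ('a \<Rightarrow> 'a) \<Rightarrow> 'b \<Rightarrow> 'b" where
  "Ad T t = T \<circ> t \<circ> cadjoint T"


section \<open>Coarse spaces\<close>

locale coarse_space =
  fixes X :: "'x set" and \<E> :: "('x \<times> 'x) set set"
  assumes entourage_subset: "E \<in> \<E> \<Longrightarrow> E \<subseteq> X \<times> X"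
    and subset_closed: "E \<in> \<E> \<Longrightarrow> F \<subseteq> E \<Longrightarrow> F \<in> \<E>"
    and union_closed: "E \<in> \<E> \<Longrightarrow> F \<in> \<E> \<Longrightarrow> E \<union> F \<in> \<E>"
    and converse_closed: "E \<in> \<E> \<Longrightarrow> converse E \<in> \<E>"
    and comp_closed: "E \<in> \<E> \<Longrightarrow> F \<in> \<E> \<Longrightarrow> E O F \<in> \<E>"
    and diagonal: "Id_on X \<in> \<E>"

text \<open>
  The neighbourhood \<open>E(A)\<close>; points of \<open>A\<close> sit in the second coordinate, so this is the image of
  \<open>A\<close> under the converse of \<open>E\<close>.
\<close>

definition thickening :: "('x \<times> 'x) set \<Rightarrow> 'x set \<Rightarrow> 'x set" where
  "thickening E A = {y. \<exists>x\<in>A. (y, x) \<in> E}"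

definition ent_bounded :: "('x \<times> 'x) set \<Rightarrow> 'x set \<Rightarrow> bool" where
  "ent_bounded E A \<longleftrightarrow> A \<times> A \<subseteq> E"

definition coarse_bounded :: "('x \<times> 'x) set set \<Rightarrow> 'x set \<Rightarrow> bool" where
  "coarse_bounded \<E> A \<longleftrightarrow> (\<exists>E\<in>\<E>. ent_bounded E A)"

text \<open>Not to be confused with the library constant \<open>gauge\<close> of gauge integration.\<close>

definition coarse_gauge :: "'x set \<Rightarrow> ('x \<times> 'x) set set \<Rightarrow> ('x \<times> 'x) set \<Rightarrow> bool" where
  "coarse_gauge X \<E> E \<longleftrightarrow> E \<in> \<E> \<and> sym E \<and> Id_on X \<subseteq> E"

definition coarsely_connected :: "'x set \<Rightarrow> ('x \<times> 'x) set set \<Rightarrow> bool" where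
  "coarsely_connected X \<E> \<longleftrightarrow> (\<forall>A\<subseteq>X. finite A \<longrightarrow> coarse_bounded \<E> A)"

definition locally_finite_partition ::
    "'x set \<Rightarrow> ('x \<times> 'x) set set \<Rightarrow> 'x set set \<Rightarrow> bool" where
  "locally_finite_partition X \<E> P \<longleftrightarrow>
     partition_on X P \<and> (\<forall>A. coarse_bounded \<E> A \<longrightarrow> finite {C \<in> P. C \<inter> A \<noteq> {}})"

definition witnesses_local_finiteness ::
    "'x set \<Rightarrow> ('x \<times> 'x) set set \<Rightarrow> ('x \<times> 'x) set \<Rightarrow> bool" where
  "witnesses_local_finiteness X \<E> E \<longleftrightarrow>
     (\<exists>P. locally_finite_partition X \<E> P \<and> (\<forall>C\<in>P. ent_bounded E C))"

definition coarsely_locally_finite :: "'x set \<Rightarrow> ('x \<times> 'x) set set \<Rightarrow> bool" where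
  "coarsely_locally_finite X \<E> \<longleftrightarrow> (\<exists>E\<in>\<E>. witnesses_local_finiteness X \<E> E)"


section \<open>Modules over coarse spaces\<close>

text \<open>
  The Hilbert space is the type \<open>'h\<close>, \<open>\<AA>\<close> is the algebra of measurable sets, and \<open>p A\<close> is the
  projection \<open>1\<^sub>A\<close>; the values of \<open>p\<close> outside \<open>\<AA>\<close> are irrelevant. In the density axiom, \<open>span\<close>
  is the real span, which agrees with the complex span because each \<open>range (p A)\<close> is a complex
  subspace.
\<close>

locale coarse_module = coarse_space X \<E> + algebra X \<AA>
  for X :: "'x set" and \<E> :: "('x \<times> 'x) set set" and \<AA> :: "'x set set" +
  fixes p :: "'x set \<Rightarrow> 'h::complex_hilbert_space \<Rightarrow> 'h"
  assumes projection: "A \<in> \<AA> \<Longrightarrow> orth_projection (p A)"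
    and p_Int: "A \<in> \<AA> \<Longrightarrow> A' \<in> \<AA> \<Longrightarrow> p (A \<inter> A') = p A \<circ> p A'"
    and p_Un: "A \<in> \<AA> \<Longrightarrow> A' \<in> \<AA> \<Longrightarrow> A \<inter> A' = {} \<Longrightarrow> p (A \<union> A') = (\<lambda>v. p A v + p A' v)"
    and p_space: "p X = id"
    and nondegenerate:
      "\<exists>E. coarse_gauge X \<E> E \<and>
         closure (span (\<Union>A \<in> {A \<in> \<AA>. ent_bounded E A}. range (p A))) = UNIV"

text \<open>Strong convergence of the sum is unconditional summability at every vector.\<close>

definition discrete_partition ::
    "'x set \<Rightarrow> ('x \<times> 'x) set set \<Rightarrow> 'x set set \<Rightarrow>
      ('x set \<Rightarrow> 'h::complex_hilbert_space \<Rightarrow> 'h) \<Rightarrow> 'x set set \<Rightarrow> bool" where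
  "discrete_partition X \<E> \<AA> p P \<longleftrightarrow>
     partition_on X P \<and> P \<subseteq> \<AA> \<and> (\<exists>E\<in>\<E>. \<forall>C\<in>P. ent_bounded E C) \<and>
     (\<forall>v. ((\<lambda>C. p C v) has_sum v) P) \<and>
     (\<forall>C\<subseteq>X. (\<forall>D\<in>P. C \<inter> D \<in> \<AA>) \<longrightarrow> C \<in> \<AA>)"

definition discrete_module ::
    "'x set \<Rightarrow> ('x \<times> 'x) set set \<Rightarrow> 'x set set \<Rightarrow>
      ('x set \<Rightarrow> 'h::complex_hilbert_space \<Rightarrow> 'h) \<Rightarrow> bool" where
  "discrete_module X \<E> \<AA> p \<longleftrightarrow> (\<exists>P. discrete_partition X \<E> \<AA> p P)"

definition witnesses_discreteness ::
    "'x set \<Rightarrow> ('x \<times> 'x) set set \<Rightarrow> 'x set set \<Rightarrow>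
      ('x set \<Rightarrow> 'h::complex_hilbert_space \<Rightarrow> 'h) \<Rightarrow> ('x \<times> 'x) set \<Rightarrow> bool" where
  "witnesses_discreteness X \<E> \<AA> p E \<longleftrightarrow>
     (\<exists>P. discrete_partition X \<E> \<AA> p P \<and> (\<forall>C\<in>P. ent_bounded E C))"

definition locally_compact_ops ::
    "('x \<times> 'x) set set \<Rightarrow> 'x set set \<Rightarrow>
      ('x set \<Rightarrow> 'h::complex_hilbert_space \<Rightarrow> 'h) \<Rightarrow> ('h \<Rightarrow> 'h) set" where
  "locally_compact_ops \<E> \<AA> p =
     {t. bounded_clinear t \<and>
         (\<forall>A\<in>\<AA>. coarse_bounded \<E> A \<longrightarrow> compact_op (t \<circ> p A) \<and> compact_op (p A \<circ> t))}"

definition Prop ::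
    "'x set set \<Rightarrow> ('x set \<Rightarrow> 'h::complex_hilbert_space \<Rightarrow> 'h) \<Rightarrow>
      ('x \<times> 'x) set \<Rightarrow> ('h \<Rightarrow> 'h) set" where
  "Prop \<AA> p E =
     {t. bounded_clinear t \<and>
         (\<forall>A\<in>\<AA>. \<forall>A'\<in>\<AA>. A' \<inter> thickening E A = {} \<longrightarrow> p A' \<circ> t \<circ> p A = (\<lambda>v. 0))}"

definition quasi_proper ::
    "'x set \<Rightarrow> ('x \<times> 'x) set set \<Rightarrow> 'x set set \<Rightarrow>
      ('x set \<Rightarrow> 'h::complex_hilbert_space \<Rightarrow> 'h) \<Rightarrow>
      ('y \<times> 'y) set set \<Rightarrow> 'y set set \<Rightarrow>
      ('y set \<Rightarrow> 'k::complex_hilbert_space \<Rightarrow> 'k) \<Rightarrow> ('h \<Rightarrow> 'k) \<Rightarrow> bool" where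
  "quasi_proper X \<E> \<AA> p \<F> \<BB> q T \<longleftrightarrow>
     (\<forall>B\<in>\<BB>. coarse_bounded \<F> B \<longrightarrow>
        (\<forall>\<epsilon>>0. \<exists>A\<in>\<AA>. coarse_bounded \<E> A \<and> onorm (q B \<circ> T \<circ> p (X - A)) \<le> \<epsilon>))"

end

theory Submission
  imports Defs
begin

text \<open>
  For (i) implies (ii), cutting \<open>T\<close> off by \<open>p A\<close> with \<open>A\<close> bounded exhibits \<open>q B \<circ> T \<circ> t \<circ> T\<^sup>*\<close> as a
  norm limit of compact operators. For (iii) implies (i), if \<open>T\<close> is not quasi-proper then one finds
  vectors \<open>v n\<close> in the unit ball, each supported on a finite family \<open>F n\<close> of pieces of the discrete
  partition, on which \<open>q B \<circ> T\<close> is bounded below. Coarse connectedness and local finiteness allow the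
  \<open>F n\<close> to be chosen so that no piece of the locally finite partition meets two of them; hence a
  bounded set meets only finitely many. The two partitions need not be related. The projection onto
  the vectors whose component in each piece \<open>C \<in> F n\<close> is a multiple of \<open>p C (v n)\<close>, and whose
  other components vanish, then is block diagonal and locally compact, and it fixes every \<open>v n\<close>, so
  its image under \<open>Ad T\<close> is not locally compact.
\<close>

section \<open>Hilbert space preliminaries\<close>

lemma bounded_clinear_linear: "bounded_clinear f \<Longrightarrow> bounded_linear f"
  and bounded_clinear_scaleC: "bounded_clinear f \<Longrightarrow> f (scaleC a x) = scaleC a (f x)"
  by (auto simp: bounded_clinear_def)

lemma bounded_clinear_compose:
  "bounded_clinear f \<Longrightarrow> bounded_clinear g \<Longrightarrow> bounded_clinear (f \<circ> g)"
  unfolding bounded_clinear_def o_def by (auto intro: bounded_linear_compose)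

lemma bounded_clinear_add:
  "bounded_clinear f \<Longrightarrow> bounded_clinear g \<Longrightarrow> bounded_clinear (\<lambda>x. f x + g x)"
  unfolding bounded_clinear_def by (auto intro: bounded_linear_add simp: scaleC_add_right)

lemma scaleC_zero_right [simp]: "scaleC a 0 = 0"
  using scaleC_add_right[of a 0 0] by simp

lemma bounded_clinear_zero: "bounded_clinear (\<lambda>x. 0)"
  by (simp add: bounded_clinear_def)

lemma scaleC_zero_left [simp]: "scaleC 0 x = 0"
  using scaleC_add_left[of 0 0 x] by simp

lemma cinner_scaleC_right: "cinner x (scaleC a y) = a * cinner x y"
  by (metis cinner_commute cinner_scaleC_left complex_cnj_cnj complex_cnj_mult)

text \<open>Antilinearity in the first argument makes the real part of
  \<open>cinner (scaleC \<i> x) y\<close> the imaginary part of \<open>cinner x y\<close>. The form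
  is thus recovered from \<open>inner\<close>, and adjoints and projections can be handled through
  the real inner product.\<close>

lemma cinner_eq_Complex: "cinner x y = Complex (inner x y) (inner (scaleC \<i> x) y)"
  by (simp add: complex_eq_iff inner_cinner cinner_scaleC_left)

lemma cinner_self: "cinner x x = complex_of_real ((norm x)\<^sup>2)"
proof -
  have "Im (cinner x x) = 0"
    using arg_cong[OF cinner_commute[of x x], of Im] by simp
  then show ?thesis
    by (simp add: complex_eq_iff power2_norm_eq_inner inner_cinner)
qed

lemma norm_scaleC: "norm (scaleC a x) = cmod a * norm x"
proof -
  have aa: "a * cnj a = complex_of_real ((cmod a)\<^sup>2)"
    by (metis complex_norm_square)
  have "cinner (scaleC a x) (scaleC a x) = (a * cnj a) * cinner x x"
    by (simp add: cinner_scaleC_left cinner_scaleC_right)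
  then have "cinner (scaleC a x) (scaleC a x) = complex_of_real ((cmod a * norm x)\<^sup>2)"
    by (simp only: aa cinner_self[of x] power_mult_distrib of_real_mult)
  then have "(norm (scaleC a x))\<^sup>2 = (cmod a * norm x)\<^sup>2"
    unfolding cinner_self of_real_eq_iff .
  then show ?thesis
    by simp
qed

lemma bounded_linear_cinner: "bounded_linear (cinner x)"
proof -
  have "cinner x = (\<lambda>y. complex_of_real (inner x y) + \<i> * complex_of_real (inner (scaleC \<i> x) y))"
    by (simp add: fun_eq_iff cinner_eq_Complex complex_eq_iff)
  moreover have "bounded_linear \<dots>"
    by (intro bounded_linear_add bounded_linear_const_mult bounded_linear_compose[OF bounded_linear_of_real]
        bounded_linear_inner_right)
  ultimately show ?thesis
    by simp
qed

lemma bounded_linear_scaleC_left: "bounded_linear (\<lambda>a. scaleC a x)"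
proof (rule bounded_linear_intro[where K = "norm x"])
  show "scaleC (r *\<^sub>R a) x = r *\<^sub>R scaleC a x" for r a
    by (simp add: scaleR_scaleC scaleC_scaleC scaleR_conv_of_real)
qed (simp_all add: scaleC_add_left norm_scaleC)

text \<open>It suffices to compare real parts, since \<open>T\<close> commutes with \<open>scaleC \<i>\<close>.\<close>

lemma cinner_eqI:
  assumes "bounded_clinear T" "\<And>x y. inner (T x) y = inner x (S y)"
  shows "cinner (T x) y = cinner x (S y)"
  by (metis assms cinner_eq_Complex bounded_clinear_scaleC)

subsection \<open>Orthogonal projections and adjoints\<close>

text \<open>A minimising sequence for the distance to \<open>W\<close> is Cauchy by the parallelogram law.\<close>

lemma closed_subspace_nearest:
  fixes W :: "'a::{real_inner, complete_space} set"
  assumes W: "subspace W" "closed W"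
  shows "\<exists>y\<in>W. \<forall>w\<in>W. norm (x - y) \<le> norm (x - w)"
proof -
  define d where "d = infdist x W"
  have ne: "W \<noteq> {}"
    using W(1) subspace_0 by blast
  have d0: "0 \<le> d"
    by (simp add: d_def infdist_nonneg)
  have dle: "d \<le> norm (x - w)" if "w \<in> W" for w
    using infdist_le[OF that, of x] by (simp add: d_def dist_norm)
  have "\<exists>w\<in>W. norm (x - w) < d + inverse (real (Suc n))" for n
  proof (rule ccontr)
    assume "\<not> ?thesis"
    then have "d + inverse (real (Suc n)) \<le> (INF w\<in>W. dist x w)"
      using ne by (intro cINF_greatest) (auto simp: dist_norm not_less)
    then have "d + inverse (real (Suc n)) \<le> d"
      using ne by (simp add: d_def infdist_def)
    then show False
      by simp
  qed
  then obtain s where s: "\<And>n. s n \<in> W" "\<And>n. norm (x - s n) < d + inverse (real (Suc n))"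
    by metis
  \<comment> \<open>\<open>c n\<close> bounds the squared distance from \<open>x\<close> to
    \<open>s n\<close>; \<open>\<eta> n\<close> is twice its excess over \<open>d\<^sup>2\<close>,
    the form in which the parallelogram law uses it.\<close>
  define c where "c n = (d + inverse (real (Suc n)))\<^sup>2" for n
  define \<eta> where "\<eta> n = 2 * (c n - d\<^sup>2)" for n
  have \<eta>: "\<eta> \<longlonglongrightarrow> 0"
  proof -
    have "\<eta> \<longlonglongrightarrow> 2 * ((d + 0)\<^sup>2 - d\<^sup>2)"
      unfolding \<eta>_def c_def by (intro tendsto_intros LIMSEQ_inverse_real_of_nat)
    then show ?thesis by simp
  qed
  have par: "(norm (s m - s n))\<^sup>2 \<le> \<eta> m + \<eta> n" for m n
  proof -
    \<comment> \<open>The midpoint stays in \<open>W\<close>, so its distance to \<open>x\<close> is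
      at least \<open>d\<close>.\<close>
    have "(1/2) *\<^sub>R (s m + s n) \<in> W"
      using W(1) s(1) by (simp add: subspace_add subspace_scale)
    then have "d\<^sup>2 \<le> (norm (x - (1/2) *\<^sub>R (s m + s n)))\<^sup>2"
      using d0 dle by (simp add: power_mono)
    moreover have "(norm (s m - s n))\<^sup>2 + 4 * (norm (x - (1/2) *\<^sub>R (s m + s n)))\<^sup>2
        = 2 * (norm (x - s m))\<^sup>2 + 2 * (norm (x - s n))\<^sup>2"
      by (simp add: power2_norm_eq_inner inner_simps inner_commute algebra_simps)
    moreover have "(norm (x - s k))\<^sup>2 \<le> c k" for k
      using s(2)[of k] unfolding c_def by (intro power_mono) auto
    from this[of m] this[of n]
    have "2 * (norm (x - s m))\<^sup>2 + 2 * (norm (x - s n))\<^sup>2 \<le> \<eta> m + \<eta> n + 4 * d\<^sup>2"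
      unfolding \<eta>_def right_diff_distrib by (simp add: algebra_simps)
    ultimately show ?thesis
      by linarith
  qed
  have "Cauchy s"
  proof (rule metric_CauchyI)
    fix e :: real assume "0 < e"
    then have "eventually (\<lambda>n. \<eta> n < e\<^sup>2 / 2) sequentially"
      by (intro order_tendstoD(2)[OF \<eta>]) simp
    then obtain M where M: "\<And>n. n \<ge> M \<Longrightarrow> \<eta> n < e\<^sup>2 / 2"
      by (auto simp: eventually_sequentially)
    have "dist (s m) (s n) < e" if "m \<ge> M" "n \<ge> M" for m n
    proof -
      have "(norm (s m - s n))\<^sup>2 < e\<^sup>2"
        using par[of m n] M[OF that(1)] M[OF that(2)] by linarith
      then show ?thesis
        using \<open>0 < e\<close> by (simp add: dist_norm power_less_imp_less_base)
    qed
    then show "\<exists>M. \<forall>m\<ge>M. \<forall>n\<ge>M. dist (s m) (s n) < e"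
      by blast
  qed
  then obtain y where y: "s \<longlonglongrightarrow> y"
    using Cauchy_convergent convergent_def by blast
  have "y \<in> W"
    using W(2) s(1) y closed_sequentially by blast
  moreover have "norm (x - y) \<le> d"
  proof (rule LIMSEQ_le)
    show "(\<lambda>n. norm (x - s n)) \<longlonglongrightarrow> norm (x - y)"
      by (intro tendsto_intros y)
    have "(\<lambda>n. d + inverse (real (Suc n))) \<longlonglongrightarrow> d + 0"
      by (intro tendsto_intros LIMSEQ_inverse_real_of_nat)
    then show "(\<lambda>n. d + inverse (real (Suc n))) \<longlonglongrightarrow> d"
      by simp
  qed (use s(2) less_imp_le in blast)
  then have "norm (x - y) \<le> norm (x - w)" if "w \<in> W" for w
    using dle[OF that] by simp
  ultimately show ?thesis
    by blast
qed

text \<open>The nearest point of \<open>W\<close> works: otherwise a shift along \<open>w\<close>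
  would bring it closer to \<open>x\<close>.\<close>

lemma orthogonal_decomposition:
  fixes W :: "'a::{real_inner, complete_space} set"
  assumes W: "subspace W" "closed W"
  shows "\<exists>y\<in>W. \<forall>w\<in>W. inner (x - y) w = 0"
proof -
  obtain y where y: "y \<in> W" "\<And>w. w \<in> W \<Longrightarrow> norm (x - y) \<le> norm (x - w)"
    using closed_subspace_nearest[OF W, of x] by blast
  have "inner (x - y) w = 0" if w: "w \<in> W" for w
  proof (cases "w = 0")
    case False
    \<comment> \<open>This \<open>r\<close> minimises the squared distance from \<open>x\<close> to
      \<open>y + r *\<^sub>R w\<close>, a quadratic polynomial in \<open>r\<close>.\<close>
    define r where "r = inner (x - y) w / (norm w)\<^sup>2"
    have "y + r *\<^sub>R w \<in> W"
      using W(1) y(1) w by (simp add: subspace_add subspace_scale)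
    then have "(norm (x - y))\<^sup>2 \<le> (norm (x - (y + r *\<^sub>R w)))\<^sup>2"
      using y(2) by (intro power_mono) auto
    also have "\<dots> = (norm (x - y))\<^sup>2 - 2 * r * inner (x - y) w + r\<^sup>2 * (norm w)\<^sup>2"
    proof -
      have "(norm (z - r *\<^sub>R w))\<^sup>2 = (norm z)\<^sup>2 - 2 * r * inner z w + r\<^sup>2 * (norm w)\<^sup>2" for z
        unfolding power2_norm_eq_inner
        by (simp add: inner_diff_left inner_diff_right inner_commute[of w z] power2_eq_square[of r] algebra_simps)
      from this[of "x - y"] show ?thesis
        by (simp add: diff_diff_add)
    qed
    also have "\<dots> = (norm (x - y))\<^sup>2 - (inner (x - y) w)\<^sup>2 / (norm w)\<^sup>2"
      using False by (simp add: r_def field_simps power2_eq_square)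
    finally have "(inner (x - y) w)\<^sup>2 / (norm w)\<^sup>2 \<le> 0"
      by simp
    then show ?thesis
      using False by (simp add: divide_le_0_iff)
  qed simp
  with y(1) show ?thesis
    by blast
qed

text \<open>A nonzero \<open>f\<close> has a vector \<open>e\<close> orthogonal to its closed kernel
  with \<open>f e \<noteq> 0\<close>. Since \<open>x - (f x / f e) *\<^sub>R e\<close> lies in the
  kernel, pairing it with \<open>e\<close> yields the formula.\<close>

lemma riesz_representation:
  fixes f :: "'a::{real_inner, complete_space} \<Rightarrow> real"
  assumes f: "bounded_linear f"
  obtains y where "\<And>x. f x = inner x y"
proof (cases "\<forall>x. f x = 0")
  case True
  then show ?thesis
    using that[of 0] by simp
next
  case False
  then obtain x0 where x0: "f x0 \<noteq> 0"
    by blast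
  interpret f: bounded_linear f by fact
  have sub: "subspace {x. f x = 0}"
    by (auto simp: subspace_def f.add f.scaleR)
  have cl: "closed {x. f x = 0}"
    by (rule closed_Collect_eq[OF linear_continuous_on[OF f] continuous_on_const])
  obtain k where k: "f k = 0" "\<And>w. f w = 0 \<Longrightarrow> inner (x0 - k) w = 0"
    using orthogonal_decomposition[OF sub cl, of x0] by auto
  define e where "e = x0 - k"
  have fe: "f e \<noteq> 0"
    using x0 k(1) by (simp add: e_def f.diff)
  then have e0: "inner e e \<noteq> 0"
    by auto
  have "f x = inner x ((f e / inner e e) *\<^sub>R e)" for x
  proof -
    have "f (x - (f x / f e) *\<^sub>R e) = 0"
      using fe by (simp add: f.diff f.scaleR)
    then have "inner e (x - (f x / f e) *\<^sub>R e) = 0"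
      using k(2) by (simp add: e_def)
    then show ?thesis
      using fe e0 by (simp add: inner_simps inner_commute field_simps)
  qed
  then show ?thesis
    using that by blast
qed

text \<open>Riesz representation supplies the value of the adjoint at each \<open>y\<close>, and
  nondegeneracy of the form makes it unique, so the definite description in \<open>cadjoint\<close>
  denotes it.\<close>

lemma cadjoint_inner:
  assumes T: "bounded_clinear T"
  shows "inner (T x) y = inner x (cadjoint T y)"
proof -
  have bl: "bounded_linear (\<lambda>x. inner (T x) y)" for y
    by (intro bounded_linear_inner_left_comp bounded_clinear_linear T)
  have "\<exists>z. \<forall>x. inner (T x) y = inner x z" for y
    using riesz_representation[OF bl[of y]] by metis
  then obtain S where S: "\<And>x y. inner (T x) y = inner x (S y)"
    by metis
  have "cadjoint T = S"
    unfolding cadjoint_def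
  proof (rule the_equality)
    show "\<forall>x y. cinner (T x) y = cinner x (S y)"
      using cinner_eqI[OF T S] by blast
    fix S' assume "\<forall>x y. cinner (T x) y = cinner x (S' y)"
    then have "inner x (S' y) = inner x (S y)" for x y
      by (metis S inner_cinner)
    then show "S' = S"
      by (intro ext) (metis vector_eq_rdot inner_commute)
  qed
  with S show ?thesis
    by simp
qed

text \<open>Testing with \<open>x = S y\<close> and applying Cauchy-Schwarz gives the bound. Any
  adjoint pair is allowed, so that a cut-off such as \<open>q B \<circ> T \<circ> p (X - A)\<close>
  can be treated without computing its \<open>cadjoint\<close>.\<close>

lemma adjoint_norm_le:
  assumes "\<And>x y. inner (T x) y = inner x (S y)" "\<And>x. norm (T x) \<le> c * norm x" "0 \<le> c"
  shows "norm (S y) \<le> c * norm y"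
proof (cases "norm (S y) = 0")
  case True
  then show ?thesis
    using assms(3) by simp
next
  case False
  have "norm (S y) * norm (S y) = inner (T (S y)) y"
    by (simp add: assms(1) flip: power2_norm_eq_inner power2_eq_square)
  also have "\<dots> \<le> norm (T (S y)) * norm y"
    by (rule norm_cauchy_schwarz)
  also have "\<dots> \<le> norm (S y) * (c * norm y)"
    using mult_right_mono[OF assms(2)[of "S y"] norm_ge_zero[of y]] by (simp add: mult_ac)
  finally show ?thesis
    using False by simp
qed

lemma adjoint_bounded_clinear:
  assumes T: "bounded_clinear T" and S: "\<And>x y. inner (T x) y = inner x (S y)"
  shows "bounded_clinear S"
proof -
  interpret T: bounded_linear T
    by (rule bounded_clinear_linear[OF T])
  have eqI: "u = v" if "\<And>x. inner x u = inner x v" for u v :: 'a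
    using that by (metis vector_eq_rdot inner_commute)
  obtain c where c: "\<And>x. norm (T x) \<le> norm x * c" "0 \<le> c"
    using T.nonneg_bounded by blast
  have "bounded_linear S"
  proof (rule bounded_linear_intro[where K = c])
    show "S (x + y) = S x + S y" for x y
      by (rule eqI) (simp add: inner_simps flip: S)
    show "S (r *\<^sub>R x) = r *\<^sub>R S x" for r x
      by (rule eqI) (simp flip: S)
    show "norm (S x) \<le> norm x * c" for x
      using adjoint_norm_le[OF S, of c x] c by (simp add: mult.commute)
  qed
  moreover have "S (scaleC a x) = scaleC a (S x)" for a x
  proof (rule eqI)
    fix z
    have "cinner z (S (scaleC a x)) = cinner z (scaleC a (S x))"
      by (simp add: cinner_scaleC_right flip: cinner_eqI[OF T S])
    then show "inner z (S (scaleC a x)) = inner z (scaleC a (S x))"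
      by (simp add: inner_cinner)
  qed
  ultimately show ?thesis
    by (simp add: bounded_clinear_def)
qed

lemma bounded_clinear_cadjoint: "bounded_clinear T \<Longrightarrow> bounded_clinear (cadjoint T)"
  using adjoint_bounded_clinear cadjoint_inner by blast

section \<open>Orthogonal projections and closed complex subspaces\<close>

lemma orth_projection_clinear: "orth_projection p \<Longrightarrow> bounded_clinear p"
  and orth_projection_idem: "orth_projection p \<Longrightarrow> p (p x) = p x"
  and orth_projection_inner: "orth_projection p \<Longrightarrow> inner (p x) y = inner x (p y)"
  by (auto simp: orth_projection_def inner_cinner dest: fun_cong)

lemma orth_projection_inner_self: "orth_projection p \<Longrightarrow> inner (p x) x = (norm (p x))\<^sup>2"
  by (metis orth_projection_idem orth_projection_inner power2_norm_eq_inner)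

lemma orth_projection_norm_le:
  assumes "orth_projection p"
  shows "norm (p x) \<le> norm x"
proof (cases "norm (p x) = 0")
  case False
  have "norm (p x) * norm (p x) \<le> norm (p x) * norm x"
    using norm_cauchy_schwarz[of "p x" x]
    by (simp add: orth_projection_inner_self[OF assms] power2_eq_square)
  with False show ?thesis
    by simp
qed simp

lemma orth_projection_onto:
  fixes W :: "'a::complex_hilbert_space set"
  assumes W: "subspace W" "closed W" "\<And>a x. x \<in> W \<Longrightarrow> scaleC a x \<in> W"
  obtains t where "orth_projection t" "\<And>x. t x \<in> W" "\<And>x. x \<in> W \<Longrightarrow> t x = x"
proof -
  have "\<exists>y. y \<in> W \<and> (\<forall>w\<in>W. inner (x - y) w = 0)" for x
    using orthogonal_decomposition[OF W(1,2)] by blast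
  then obtain t where tW: "\<And>x. t x \<in> W" and t: "\<And>x w. w \<in> W \<Longrightarrow> inner (x - t x) w = 0"
    by metis
  \<comment> \<open>\<open>t x\<close> is the only point of \<open>W\<close> whose difference from
    \<open>x\<close> is orthogonal to \<open>W\<close>; linearity follows by checking this property
    for the expected values.\<close>
  have uniq: "t x = y" if "y \<in> W" "\<And>w. w \<in> W \<Longrightarrow> inner (x - y) w = 0" for x y
  proof -
    have "t x - y \<in> W"
      by (simp add: W(1) tW subspace_diff that(1))
    then have "inner (x - y) (t x - y) - inner (x - t x) (t x - y) = 0"
      using t that(2) by simp
    then have "inner (t x - y) (t x - y) = 0"
      by (simp flip: inner_diff_left)
    then show ?thesis by simp
  qed
  have id: "t x = x" if "x \<in> W" for x
    by (rule uniq) (simp_all add: that)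
  have sym: "inner (t x) y = inner x (t y)" for x y
    using t[OF tW[of y], of x] t[OF tW[of x], of y] by (simp add: inner_simps inner_commute)
  have norm: "norm (t x) \<le> norm x * 1" for x
  proof -
    have "inner (t x) x = (norm (t x))\<^sup>2"
      by (metis id power2_norm_eq_inner sym tW)
    then have "norm (t x) * norm (t x) \<le> norm (t x) * norm x"
      using norm_cauchy_schwarz[of "t x" x] by (simp add: power2_eq_square)
    then show ?thesis
      by (cases "norm (t x) = 0") auto
  qed
  have "bounded_linear t"
  proof (rule bounded_linear_intro[OF _ _ norm])
    show "t (x + y) = t x + t y" for x y
    proof (rule uniq)
      show "inner (x + y - (t x + t y)) w = 0" if "w \<in> W" for w
        using t[OF that, of x] t[OF that, of y] by (simp add: inner_simps)
    qed (simp add: W(1) tW subspace_add)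
    show "t (r *\<^sub>R x) = r *\<^sub>R t x" for r x
    proof (rule uniq)
      show "inner (r *\<^sub>R x - r *\<^sub>R t x) w = 0" if "w \<in> W" for w
        using t[OF that, of x] by (simp flip: scaleR_diff_right)
    qed (simp add: W(1) tW subspace_scale)
  qed
  moreover have "t (scaleC a x) = scaleC a (t x)" for a x
  proof (rule uniq)
    fix w assume "w \<in> W"
    have "scaleC a x - scaleC a (t x) = scaleC a (x - t x)"
      using scaleC_add_right[of a "x - t x" "t x"] by simp
    moreover have "inner (scaleC a (x - t x)) w = inner (x - t x) (scaleC (cnj a) w)"
      by (simp add: inner_cinner cinner_scaleC_left cinner_scaleC_right)
    ultimately show "inner (scaleC a x - scaleC a (t x)) w = 0"
      using t W(3) \<open>w \<in> W\<close> by simp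
  qed (simp add: W(3) tW)
  ultimately have "bounded_clinear t"
    by (simp add: bounded_clinear_def)
  then have "orth_projection t"
    unfolding orth_projection_def using cinner_eqI sym id tW by fastforce
  with tW id show ?thesis
    using that by blast
qed

text \<open>As \<open>a\<close> maps \<open>W\<close> into itself,
  \<open>t \<circ> a \<circ> t = a \<circ> t\<close>. The left side is self-adjoint, so the right
  side equals its own adjoint \<open>t \<circ> a\<close>.\<close>

lemma orth_projection_commute:
  assumes t: "orth_projection t" "\<And>x. x \<in> W \<Longrightarrow> t x = x" "\<And>x. t x \<in> W"
    and a: "orth_projection a" "\<And>x. x \<in> W \<Longrightarrow> a x \<in> W"
  shows "t (a x) = a (t x)"
proof -
  have inv: "t (a (t z)) = a (t z)" for z
    using a(2) t(2,3) by blast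
  have "inner y (t (a x)) = inner y (a (t x))" for y
    by (metis inv orth_projection_inner[OF t(1)] orth_projection_inner[OF a(1)])
  then show ?thesis
    by (metis vector_eq_rdot inner_commute)
qed

subsection \<open>Compact operators\<close>

lemma compact_opI:
  assumes "bounded_clinear f" "compact K" "f ` cball 0 1 \<subseteq> K"
  shows "compact_op f"
  unfolding compact_op_def
proof
  have "closure (f ` cball 0 1) \<subseteq> K"
    by (simp add: assms closure_minimal compact_imp_closed)
  then show "compact (closure (f ` cball 0 1))"
    using compact_Int_closed[OF assms(2) closed_closure, of "f ` cball 0 1"] by (simp add: Int_absorb1)
qed fact

lemma compact_op_clinear: "compact_op f \<Longrightarrow> bounded_clinear f"
  by (simp add: compact_op_def)

lemma compact_opE:
  assumes "compact_op f"
  obtains K where "compact K" "\<And>x. norm x \<le> 1 \<Longrightarrow> f x \<in> K"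
proof (rule that)
  show "compact (closure (f ` cball 0 1))"
    using assms by (simp add: compact_op_def)
  show "f x \<in> closure (f ` cball 0 1)" if "norm x \<le> 1" for x
    using that by (intro subsetD[OF closure_subset] imageI) simp
qed

lemma compact_op_compose_left:
  assumes g: "bounded_clinear g" and f: "compact_op f"
  shows "compact_op (g \<circ> f)"
proof -
  obtain K where K: "compact K" "\<And>x. norm x \<le> 1 \<Longrightarrow> f x \<in> K"
    using compact_opE[OF f] by blast
  show ?thesis
  proof (rule compact_opI)
    show "bounded_clinear (g \<circ> f)"
      by (intro bounded_clinear_compose compact_op_clinear g f)
    show "compact (g ` K)"
      by (intro compact_continuous_image linear_continuous_on bounded_clinear_linear g K)
  qed (use K in auto)
qed

text \<open>\<open>g\<close> maps the unit ball into a ball of radius \<open>c\<close>, so the image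
  under \<open>f\<close> lies in the compact set \<open>K\<close> scaled by
  \<open>c\<close>.\<close>

lemma compact_op_compose_right:
  assumes f: "compact_op f" and g: "bounded_clinear g"
  shows "compact_op (f \<circ> g)"
proof -
  obtain K where K: "compact K" "\<And>x. norm x \<le> 1 \<Longrightarrow> f x \<in> K"
    using compact_opE[OF f] by blast
  obtain c where c: "c > 0" "\<And>x. norm (g x) \<le> norm x * c"
    using bounded_linear.pos_bounded[OF bounded_clinear_linear[OF g]] by blast
  interpret f: bounded_linear f
    by (intro bounded_clinear_linear compact_op_clinear f)
  show ?thesis
  proof (rule compact_opI)
    show "bounded_clinear (f \<circ> g)"
      by (intro bounded_clinear_compose compact_op_clinear g f)
    show "compact ((*\<^sub>R) c ` K)"
      by (intro compact_scaling K)
    have "f (g x) \<in> (*\<^sub>R) c ` K" if "norm x \<le> 1" for x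
    proof
      have "norm (g x) \<le> c"
        using c(2)[of x] that c(1) by (metis less_imp_le mult_left_le_one_le norm_ge_zero order_trans)
      then show "f (inverse c *\<^sub>R g x) \<in> K"
        using c(1) by (intro K) (simp add: field_simps)
      show "f (g x) = c *\<^sub>R f (inverse c *\<^sub>R g x)"
        using c(1) by (simp add: f.scaleR)
    qed
    then show "(f \<circ> g) ` cball 0 1 \<subseteq> (*\<^sub>R) c ` K"
      by auto
  qed
qed

lemma compact_op_zero: "compact_op (\<lambda>x. 0)"
  by (rule compact_opI[where K = "{0}"]) (auto simp: bounded_clinear_zero)

lemma compact_op_add:
  assumes "compact_op f" "compact_op g"
  shows "compact_op (\<lambda>x. f x + g x)"
proof -
  obtain K where K: "compact K" "\<And>x. norm x \<le> 1 \<Longrightarrow> f x \<in> K"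
    using compact_opE[OF assms(1)] by blast
  obtain L where L: "compact L" "\<And>x. norm x \<le> 1 \<Longrightarrow> g x \<in> L"
    using compact_opE[OF assms(2)] by blast
  show ?thesis
  proof (rule compact_opI)
    show "compact {x + y | x y. x \<in> K \<and> y \<in> L}"
      by (intro compact_sums K L)
    show "bounded_clinear (\<lambda>x. f x + g x)"
      by (intro bounded_clinear_add compact_op_clinear assms)
    show "(\<lambda>x. f x + g x) ` cball 0 1 \<subseteq> {x + y | x y. x \<in> K \<and> y \<in> L}"
      using K(2) L(2) by fastforce
  qed
qed

lemma compact_op_sum:
  assumes "finite G" "\<And>C. C \<in> G \<Longrightarrow> compact_op (f C)"
  shows "compact_op (\<lambda>x. \<Sum>C\<in>G. f C x)"
  using assms by (induction G) (simp_all add: compact_op_zero compact_op_add)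

text \<open>A finite net for the image of the unit ball under an approximant \<open>g\<close> is
  also one for its image under \<open>f\<close>, at a larger radius.\<close>

lemma compact_op_limit:
  fixes f :: "'a::complex_hilbert_space \<Rightarrow> 'b::complex_hilbert_space"
  assumes f: "bounded_clinear f"
    and lim: "\<And>e. e > 0 \<Longrightarrow> \<exists>g. compact_op g \<and> (\<forall>x. norm x \<le> 1 \<longrightarrow> norm (f x - g x) \<le> e)"
  shows "compact_op f"
  unfolding compact_op_def compact_eq_totally_bounded
proof (intro conjI allI impI f)
  show "complete (closure (f ` cball 0 1))"
    by (simp add: complete_eq_closed)
  fix e :: real assume e: "e > 0"
  then obtain g where g: "compact_op g" "\<And>x. norm x \<le> 1 \<Longrightarrow> norm (f x - g x) \<le> e/4"
    using lim[of "e/4"] by auto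
  obtain K where K: "compact K" "\<And>x. norm x \<le> 1 \<Longrightarrow> g x \<in> K"
    using compact_opE[OF g(1)] by blast
  obtain k where k: "finite k" "K \<subseteq> (\<Union>x\<in>k. ball x (e/4))"
    using K(1) e unfolding compact_eq_totally_bounded by (meson divide_pos_pos zero_less_numeral)
  \<comment> \<open>The balls are closed and of radius only \<open>e/2\<close> so that their finite
    union also contains the closure of the image and still fits into open balls of radius
    \<open>e\<close>.\<close>
  have "f ` cball 0 1 \<subseteq> (\<Union>x\<in>k. cball x (e/2))"
  proof
    fix y assume "y \<in> f ` cball 0 1"
    then obtain x where x: "norm x \<le> 1" "y = f x"
      by auto
    then obtain z where z: "z \<in> k" "dist z (g x) < e/4"
      using k(2) K(2) by fastforce
    have "dist z y \<le> dist z (g x) + dist (g x) y"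
      by (rule dist_triangle)
    also have "\<dots> \<le> e/2"
      using z(2) g(2)[OF x(1)] x(2) by (simp add: dist_norm norm_minus_commute)
    finally show "y \<in> (\<Union>x\<in>k. cball x (e/2))"
      using z(1) by auto
  qed
  moreover have "closed (\<Union>x\<in>k. cball x (e/2))"
    using k(1) by auto
  ultimately have "closure (f ` cball 0 1) \<subseteq> (\<Union>x\<in>k. cball x (e/2))"
    by (rule closure_minimal)
  also have "\<dots> \<subseteq> (\<Union>x\<in>k. ball x e)"
    using e by force
  finally show "\<exists>k. finite k \<and> closure (f ` cball 0 1) \<subseteq> (\<Union>x\<in>k. ball x e)"
    using k(1) by blast
qed

section \<open>Projections onto lines\<close>

text \<open>For \<open>u = 0\<close> the quotient is the junk value \<open>0 / 0 = 0\<close>, so the operator is \<open>0\<close> as desired.\<close>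

definition line_projection :: "'a::complex_hilbert_space \<Rightarrow> 'a \<Rightarrow> 'a" where
  "line_projection u x = scaleC (cinner u x / cinner u u) u"

lemma bounded_clinear_line_projection: "bounded_clinear (line_projection u)"
proof -
  have "bounded_linear (\<lambda>x. scaleC (cinner u x / cinner u u) u)"
    by (intro bounded_linear_compose[OF bounded_linear_scaleC_left]
        bounded_linear_compose[OF bounded_linear_divide] bounded_linear_cinner)
  then show ?thesis
    by (simp add: bounded_clinear_def line_projection_def[abs_def] cinner_scaleC_right scaleC_scaleC)
qed

lemma line_projection_self: "line_projection u u = u"
  by (cases "u = 0") (simp_all add: line_projection_def scaleC_one cinner_self)

text \<open>The operator factors through the scalars: the unit ball goes to the image of a closed
  disc, which is compact.\<close>

lemma compact_op_line_projection: "compact_op (line_projection u)"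
proof -
  have cont: "bounded_linear (\<lambda>x. cinner u x / cinner u u)"
    by (intro bounded_linear_compose[OF bounded_linear_divide] bounded_linear_cinner)
  obtain c where c: "\<And>x. norm (cinner u x / cinner u u) \<le> norm x * c" "c > 0"
    using bounded_linear.pos_bounded[OF cont] by blast
  show ?thesis
  proof (rule compact_opI[OF bounded_clinear_line_projection])
    show "compact ((\<lambda>a. scaleC a u) ` cball 0 c)"
      by (intro compact_continuous_image linear_continuous_on bounded_linear_scaleC_left compact_cball)
    have "norm (cinner u x / cinner u u) \<le> c" if "norm x \<le> 1" for x
      using c(1)[of x] c(2) that by (metis less_imp_le mult_left_le_one_le norm_ge_zero order_trans)
    then show "line_projection u ` cball 0 1 \<subseteq> (\<lambda>a. scaleC a u) ` cball 0 c"
      by (auto simp: line_projection_def)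
  qed
qed

section \<open>Orthogonal sequences and failure of compactness\<close>

text \<open>Pairing \<open>w\<close> with \<open>\<Sum>i<M. v i\<close>, whose norm is at most \<open>sqrt M\<close>, gives \<open>M * \<delta> \<le> norm w * sqrt M\<close>.\<close>

lemma orthogonal_sequence_inner_bound:
  fixes w :: "'a::real_inner" and v :: "nat \<Rightarrow> 'a"
  assumes orth: "\<And>m n. m \<noteq> n \<Longrightarrow> inner (v m) (v n) = 0"
    and norm: "\<And>n. norm (v n) \<le> 1"
    and le: "\<And>n. \<delta> \<le> inner w (v n)"
  shows "\<delta> \<le> (0::real)"
proof (rule ccontr)
  assume "\<not> \<delta> \<le> 0"
  then have \<delta>: "\<delta> > 0"
    by simp
  have sq: "(norm (\<Sum>i<M. v i))\<^sup>2 \<le> real M" for M :: nat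
  proof (induction M)
    case (Suc M)
    have "inner (\<Sum>i<M. v i) (v M) = 0"
      by (simp add: inner_sum_left orth)
    then have "(norm (\<Sum>i<Suc M. v i))\<^sup>2 = (norm (\<Sum>i<M. v i))\<^sup>2 + (norm (v M))\<^sup>2"
      by (simp add: norm_add_Pythagorean orthogonal_def)
    also have "\<dots> \<le> real M + 1"
      using Suc.IH norm[of M] by (intro add_mono) (auto simp: power_le_one)
    finally show ?case
      by simp
  qed simp
  obtain M :: nat where M: "(norm w)\<^sup>2 / \<delta>\<^sup>2 < real M"
    using reals_Archimedean2 by blast
  then have M0: "real M > 0"
    using order_le_less_trans[OF _ M, of 0] by simp
  have "real M * \<delta> \<le> (\<Sum>i<M. inner w (v i))"
    using sum_bounded_below[of "{..<M}" \<delta> "\<lambda>i. inner w (v i)"] le by simp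
  also have "\<dots> = inner w (\<Sum>i<M. v i)"
    by (simp add: inner_sum_right)
  also have "\<dots> \<le> norm w * norm (\<Sum>i<M. v i)"
    by (rule norm_cauchy_schwarz)
  finally have "(real M * \<delta>)\<^sup>2 \<le> (norm w * norm (\<Sum>i<M. v i))\<^sup>2"
    using \<delta> M0 by (intro power_mono) auto
  also have "\<dots> \<le> (norm w)\<^sup>2 * real M"
    using sq by (simp add: power_mult_distrib mult_left_mono)
  finally have "real M * \<delta>\<^sup>2 \<le> (norm w)\<^sup>2"
    using M0 by (simp add: power_mult_distrib power2_eq_square[of "real M"])
  with M \<delta> show False
    by (simp add: field_simps)
qed

text \<open>
  With \<open>y n = q (T (v n))\<close> and \<open>z n = t (T\<^sup>* (y n))\<close> one has
  \<open>norm (z m - z n)\<^sup>2 = inner (K (y m - y n)) (y m - y n)\<close> for \<open>K = q \<circ> Ad T t\<close>, so \<open>z\<close> has a Cauchy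
  subsequence if \<open>K\<close> is compact, whereas \<open>inner (z n) (v n) = norm (y n)\<^sup>2\<close>.
\<close>

lemma not_compact_op_Ad:
  fixes T :: "'h::complex_hilbert_space \<Rightarrow> 'k::complex_hilbert_space" and v :: "nat \<Rightarrow> 'h"
  assumes T: "bounded_clinear T" and q: "orth_projection q" and t: "orth_projection t"
    and tv: "\<And>n. t (v n) = v n"
    and orth: "\<And>m n. m \<noteq> n \<Longrightarrow> inner (v m) (v n) = 0"
    and norm: "\<And>n. norm (v n) \<le> 1"
    and big: "\<And>n. \<epsilon> < norm (q (T (v n)))" and \<epsilon>: "\<epsilon> > 0"
  shows "\<not> compact_op (q \<circ> Ad T t)"
proof
  define K where "K = q \<circ> Ad T t"
  define S where "S = cadjoint T"
  define y where "y n = q (T (v n))" for n :: nat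
  define z where "z n = t (S (y n))" for n
  assume "compact_op (q \<circ> Ad T t)"
  then have K: "compact_op K"
    by (simp add: K_def)
  interpret K: bounded_linear K
    by (intro bounded_clinear_linear compact_op_clinear K)
  interpret q: bounded_linear q
    by (intro bounded_clinear_linear orth_projection_clinear q)
  interpret t: bounded_linear t
    by (intro bounded_clinear_linear orth_projection_clinear t)
  interpret S: bounded_linear S
    unfolding S_def by (intro bounded_clinear_linear bounded_clinear_cadjoint T)
  have TS: "inner (T a) b = inner a (S b)" for a b
    unfolding S_def by (rule cadjoint_inner[OF T])
  obtain c where c: "c > 0" "\<And>x. norm (T x) \<le> norm x * c"
    using bounded_linear.pos_bounded[OF bounded_clinear_linear[OF T]] by blast
  have yc: "norm (y n) \<le> c" for n
  proof -
    have "norm (y n) \<le> norm (T (v n))"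
      unfolding y_def by (rule orth_projection_norm_le[OF q])
    also have "\<dots> \<le> norm (v n) * c"
      by (rule c)
    also have "\<dots> \<le> c"
      using norm[of n] c(1) by simp
    finally show ?thesis .
  qed
  have qy: "q (y n) = y n" for n
    by (simp add: y_def orth_projection_idem[OF q])
  have zv: "\<epsilon>\<^sup>2 \<le> inner (z n) (v n)" for n
  proof -
    have "inner (z n) (v n) = inner (S (y n)) (v n)"
      by (simp add: z_def orth_projection_inner[OF t] tv)
    also have "\<dots> = inner (T (v n)) (q (y n))"
      by (simp add: inner_commute[of "S (y n)"] TS qy)
    also have "\<dots> = (norm (y n))\<^sup>2"
      by (simp add: y_def power2_norm_eq_inner flip: orth_projection_inner[OF q])
    finally show ?thesis
      using big[of n] \<epsilon> by (simp add: y_def power_mono)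
  qed
  have zz: "(norm (z m - z n))\<^sup>2 \<le> norm (K (y m) - K (y n)) * (2 * c)" for m n
  proof -
    define b where "b = y m - y n"
    have qb: "q b = b"
      by (simp add: b_def q.diff qy)
    have "norm b \<le> 2 * c"
      using norm_triangle_ineq4[of "y m" "y n"] yc[of m] yc[of n] by (simp add: b_def)
    have "z m - z n = t (S b)"
      by (simp add: z_def b_def S.diff t.diff)
    then have "(norm (z m - z n))\<^sup>2 = inner (t (S b)) (S b)"
      by (simp add: orth_projection_inner_self[OF t])
    also have "\<dots> = inner (T (t (S b))) (q b)"
      by (simp add: TS qb)
    also have "\<dots> = inner (K b) b"
      by (simp add: K_def Ad_def S_def orth_projection_inner[OF q])
    also have "\<dots> \<le> norm (K b) * norm b"
      by (rule norm_cauchy_schwarz)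
    also have "\<dots> \<le> norm (K b) * (2 * c)"
      using \<open>norm b \<le> 2 * c\<close> by (intro mult_left_mono) auto
    finally show ?thesis
      by (simp add: b_def K.diff)
  qed
  obtain L where L: "compact L" "\<And>x. norm x \<le> 1 \<Longrightarrow> K x \<in> L"
    using compact_opE[OF K] by blast
  \<comment> \<open>Dividing by \<open>c\<close> moves \<open>y n\<close> into the unit ball, where
    compactness of \<open>K\<close> applies; the factor is restored after a convergent subsequence
    is extracted.\<close>
  define x where "x n = K (inverse c *\<^sub>R y n)" for n
  have "\<forall>n. x n \<in> L"
    using yc c(1) unfolding x_def by (intro allI L) (simp add: field_simps)
  then obtain l r where r: "strict_mono r" "(x \<circ> r) \<longlonglongrightarrow> l"
    using L(1) unfolding compact_def by blast
  have "(\<lambda>n. c *\<^sub>R (x \<circ> r) n) \<longlonglongrightarrow> c *\<^sub>R l"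
    by (intro tendsto_intros r)
  then have "Cauchy (\<lambda>n. K (y (r n)))"
    using c(1) by (intro LIMSEQ_imp_Cauchy[of _ "c *\<^sub>R l"]) (simp add: x_def K.scaleR)
  \<comment> \<open>With this threshold \<open>zz\<close> puts the vectors \<open>z (r n)\<close>
    within \<open>\<epsilon>\<^sup>2/2\<close> of each other, half of the lower bound in
    \<open>zv\<close>.\<close>
  moreover have "(\<epsilon>\<^sup>2/2)\<^sup>2 / (2 * c) > 0"
    using \<epsilon> c(1) by simp
  ultimately obtain N where N: "\<And>m n. m \<ge> N \<Longrightarrow> n \<ge> N \<Longrightarrow>
      dist (K (y (r m))) (K (y (r n))) < (\<epsilon>\<^sup>2/2)\<^sup>2 / (2 * c)"
    unfolding Cauchy_def by metis
  \<comment> \<open>The single vector \<open>z (r N)\<close> thus has pairings bounded below with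
    infinitely many mutually orthogonal vectors of the unit ball, which is impossible.\<close>
  have "\<epsilon>\<^sup>2 / 2 \<le> inner (z (r N)) (v (r (N + n)))" for n
  proof -
    have "(norm (z (r (N + n)) - z (r N)))\<^sup>2 \<le> norm (K (y (r (N + n))) - K (y (r N))) * (2 * c)"
      by (rule zz)
    also have "\<dots> \<le> (\<epsilon>\<^sup>2/2)\<^sup>2 / (2 * c) * (2 * c)"
      using N[of "N + n" N] c(1) by (intro mult_right_mono) (auto simp: dist_norm)
    also have "\<dots> = (\<epsilon>\<^sup>2/2)\<^sup>2"
      using c(1) by simp
    finally have "norm (z (r (N + n)) - z (r N)) \<le> \<epsilon>\<^sup>2/2"
      by (rule power2_le_imp_le) simp
    moreover have "inner (z (r (N + n)) - z (r N)) (v (r (N + n))) \<le> norm (z (r (N + n)) - z (r N)) * 1"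
      by (rule order_trans[OF norm_cauchy_schwarz]) (intro mult_left_mono norm norm_ge_zero)
    ultimately show ?thesis
      using zv[of "r (N + n)"] by (simp add: inner_diff_left)
  qed
  moreover have "inner (v (r (N + m))) (v (r (N + n))) = 0" if "m \<noteq> n" for m n
    using that r(1) by (intro orth) (simp add: strict_mono_eq)
  ultimately have "\<epsilon>\<^sup>2 / 2 \<le> 0"
    using norm by (intro orthogonal_sequence_inner_bound[of "\<lambda>n. v (r (N + n))"]) auto
  with \<epsilon> show False
    by simp
qed

section \<open>Bounded sets\<close>

context coarse_space
begin

lemma coarse_bounded_space: "coarse_bounded \<E> A \<Longrightarrow> A \<subseteq> X"
  using entourage_subset by (fastforce simp: coarse_bounded_def ent_bounded_def)

lemma coarse_bounded_empty: "coarse_bounded \<E> {}"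
  using diagonal by (auto simp: coarse_bounded_def ent_bounded_def)

text \<open>Connectedness provides an entourage joining one point of \<open>A\<close> to one point
  of \<open>B\<close>; any other pair is joined by passing through these two points.\<close>

lemma coarse_bounded_Un:
  assumes conn: "coarsely_connected X \<E>"
    and A: "coarse_bounded \<E> A" and B: "coarse_bounded \<E> B"
  shows "coarse_bounded \<E> (A \<union> B)"
proof (cases "A = {} \<or> B = {}")
  case False
  then obtain a b where ab: "a \<in> A" "b \<in> B"
    by blast
  obtain EA where EA: "EA \<in> \<E>" "A \<times> A \<subseteq> EA"
    using A by (auto simp: coarse_bounded_def ent_bounded_def)
  obtain EB where EB: "EB \<in> \<E>" "B \<times> B \<subseteq> EB"
    using B by (auto simp: coarse_bounded_def ent_bounded_def)
  have "{a, b} \<subseteq> X"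
    using ab A B coarse_bounded_space by blast
  then obtain F where F: "F \<in> \<E>" "{a, b} \<times> {a, b} \<subseteq> F"
    using conn unfolding coarsely_connected_def coarse_bounded_def ent_bounded_def
    by (meson finite.emptyI finite.insertI)
  define G where "G = EA O F O EB"
  have G: "G \<in> \<E>"
    using EA EB F by (simp add: G_def comp_closed)
  have "A \<times> B \<subseteq> G"
    using ab EA(2) EB(2) F(2) by (fastforce simp: G_def)
  then have "(A \<union> B) \<times> (A \<union> B) \<subseteq> EA \<union> EB \<union> (G \<union> converse G)"
    using EA(2) EB(2) by blast
  moreover have "EA \<union> EB \<union> (G \<union> converse G) \<in> \<E>"
    using EA(1) EB(1) G by (simp add: union_closed converse_closed)
  ultimately show ?thesis
    by (auto simp: coarse_bounded_def ent_bounded_def)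
qed (use A B in auto)

lemma coarse_bounded_finite_Union:
  assumes "coarsely_connected X \<E>" "finite \<A>" "\<And>A. A \<in> \<A> \<Longrightarrow> coarse_bounded \<E> A"
  shows "coarse_bounded \<E> (\<Union>\<A>)"
  using assms(2,3) by (induction \<A>) (auto simp: coarse_bounded_empty intro: coarse_bounded_Un assms(1))

text \<open>Two points of the union are joined in three steps: inside a piece to \<open>U\<close>,
  across \<open>U\<close>, and inside a piece again.\<close>

lemma coarse_bounded_star:
  assumes E: "E \<in> \<E>" "\<And>C. C \<in> P \<Longrightarrow> ent_bounded E C" and U: "coarse_bounded \<E> U"
  shows "coarse_bounded \<E> (\<Union>{C \<in> P. C \<inter> U \<noteq> {}})"
proof -
  obtain F where F: "F \<in> \<E>" "U \<times> U \<subseteq> F"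
    using U by (auto simp: coarse_bounded_def ent_bounded_def)
  have "E O F O E \<in> \<E>"
    using E(1) F(1) by (simp add: comp_closed)
  moreover have "(x, y) \<in> E O F O E"
    if C: "C \<in> P" "C \<inter> U \<noteq> {}" "x \<in> C" and D: "D \<in> P" "D \<inter> U \<noteq> {}" "y \<in> D" for x y C D
  proof -
    obtain a b where "a \<in> C \<inter> U" "b \<in> D \<inter> U"
      using C D by blast
    then have "(x, a) \<in> E" "(a, b) \<in> F" "(b, y) \<in> E"
      using C D E(2) F(2) by (auto simp: ent_bounded_def)
    then show ?thesis
      by blast
  qed
  ultimately show ?thesis
    unfolding coarse_bounded_def ent_bounded_def by (intro bexI[of _ "E O F O E"]) blast+
qed

end

section \<open>Operators on modules\<close>

context coarse_module
begin

lemma p_linear: "A \<in> \<AA> \<Longrightarrow> bounded_linear (p A)"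
  by (intro bounded_clinear_linear orth_projection_clinear projection)

lemma p_clinear: "A \<in> \<AA> \<Longrightarrow> bounded_clinear (p A)"
  by (intro orth_projection_clinear projection)

lemma p_p: "A \<in> \<AA> \<Longrightarrow> B \<in> \<AA> \<Longrightarrow> p A (p B x) = p (A \<inter> B) x"
  by (simp add: p_Int)

lemma p_empty: "p {} x = 0"
  using fun_cong[OF p_Un[of "{}" "{}"], of x] by simp

lemma p_compl:
  assumes "A \<in> \<AA>"
  shows "x = p A x + p (X - A) x"
proof -
  have "p (A \<union> (X - A)) = (\<lambda>v. p A v + p (X - A) v)"
    using assms by (intro p_Un) auto
  moreover have "A \<union> (X - A) = X"
    using assms sets_into_space by blast
  ultimately have "p X x = p A x + p (X - A) x"
    by (metis (no_types))
  then show ?thesis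
    by (simp add: p_space)
qed

lemma p_finite_Union:
  assumes "finite F" "F \<subseteq> \<AA>" "disjoint F"
  shows "p (\<Union>F) x = (\<Sum>C\<in>F. p C x)"
  using assms
proof (induction F)
  case (insert C F)
  have "p (C \<union> \<Union>F) = (\<lambda>v. p C v + p (\<Union>F) v)"
    using insert by (intro p_Un) (auto simp: pairwise_insert disjnt_def)
  with insert show ?case
    by (simp add: pairwise_insert)
qed (simp add: p_empty)

section \<open>Quasi-proper operators preserve local compactness\<close>

lemma quasi_proper_compact:
  fixes q :: "'y set \<Rightarrow> 'k::complex_hilbert_space \<Rightarrow> 'k"
  assumes qp: "quasi_proper X \<E> \<AA> p \<F> \<BB> q T" and T: "bounded_clinear T"
    and t: "t \<in> locally_compact_ops \<E> \<AA> p"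
    and B: "B \<in> \<BB>" "coarse_bounded \<F> B" and q: "orth_projection (q B)"
  shows "compact_op (Ad T t \<circ> q B)" "compact_op (q B \<circ> Ad T t)"
proof -
  define S where "S = cadjoint T"
  have TS: "inner (T a) b = inner a (S b)" for a b
    unfolding S_def by (rule cadjoint_inner[OF T])
  have S: "bounded_clinear S"
    unfolding S_def by (intro bounded_clinear_cadjoint T)
  have tc: "bounded_clinear t"
    using t by (simp add: locally_compact_ops_def)
  have qc: "bounded_clinear (q B)"
    by (intro orth_projection_clinear q)
  have cutoff: "\<exists>A\<in>\<AA>. compact_op (t \<circ> p A) \<and> compact_op (p A \<circ> t) \<and>
      (\<forall>x. norm (q B (T (p (X - A) x))) \<le> \<epsilon> * norm x)" if "\<epsilon> > 0" for \<epsilon>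
  proof -
    obtain A where A: "A \<in> \<AA>" "coarse_bounded \<E> A" "onorm (q B \<circ> T \<circ> p (X - A)) \<le> \<epsilon>"
      using qp B \<open>\<epsilon> > 0\<close> unfolding quasi_proper_def by blast
    have "bounded_linear (q B \<circ> T \<circ> p (X - A))"
      using A(1) by (intro bounded_clinear_linear bounded_clinear_compose qc T p_clinear) auto
    then have "norm (q B (T (p (X - A) x))) \<le> \<epsilon> * norm x" for x
      using order_trans[OF onorm mult_right_mono[OF A(3) norm_ge_zero]] by fastforce
    with A(1,2) t show ?thesis
      unfolding locally_compact_ops_def by blast
  qed
  show "compact_op (q B \<circ> Ad T t)"
  proof (rule compact_op_limit)
    show "bounded_clinear (q B \<circ> Ad T t)"
      unfolding Ad_def S_def[symmetric] by (intro bounded_clinear_compose qc T tc S)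
    fix \<delta> :: real assume "\<delta> > 0"
    obtain c where c: "c > 0" "\<And>x. norm (t (S x)) \<le> norm x * c"
      using bounded_linear.pos_bounded[OF bounded_clinear_linear[OF bounded_clinear_compose[OF tc S]]]
      by auto
    obtain A where A: "A \<in> \<AA>" "compact_op (p A \<circ> t)"
      \<comment> \<open>Here \<open>c\<close> bounds the factor \<open>t \<circ> S\<close>, so
        tolerance \<open>\<delta> / c\<close> in the cut-off gives total error
        \<open>\<delta>\<close>.\<close>
      "\<And>x. norm (q B (T (p (X - A) x))) \<le> \<delta> / c * norm x"
      using cutoff[of "\<delta> / c"] c(1) \<open>\<delta> > 0\<close> by auto
    interpret R: bounded_linear "q B \<circ> T"
      by (intro bounded_clinear_linear bounded_clinear_compose qc T)
    have "compact_op ((q B \<circ> T) \<circ> (p A \<circ> t) \<circ> S)"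
      by (intro compact_op_compose_left compact_op_compose_right bounded_clinear_compose A qc T S)
    moreover have "norm ((q B \<circ> Ad T t) x - ((q B \<circ> T) \<circ> (p A \<circ> t) \<circ> S) x) \<le> \<delta>" if "norm x \<le> 1" for x
    proof -
      define b where "b = t (S x)"
      have "(q B \<circ> Ad T t) x - ((q B \<circ> T) \<circ> (p A \<circ> t) \<circ> S) x = (q B \<circ> T) (b - p A b)"
        unfolding R.diff by (simp add: Ad_def S_def b_def)
      also have "b - p A b = p (X - A) b"
        using p_compl[OF A(1), of b] by (simp add: algebra_simps)
      also have "norm ((q B \<circ> T) (p (X - A) b)) \<le> \<delta> / c * norm b"
        using A(3) by simp
      also have "\<dots> \<le> \<delta> / c * (1 * c)"
        using c \<open>\<delta> > 0\<close> that unfolding b_def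
        by (intro mult_left_mono order_trans[OF c(2)] mult_right_mono) auto
      finally show ?thesis
        using c(1) by simp
    qed
    ultimately show "\<exists>g. compact_op g \<and> (\<forall>x. norm x \<le> 1 \<longrightarrow> norm ((q B \<circ> Ad T t) x - g x) \<le> \<delta>)"
      by blast
  qed
  show "compact_op (Ad T t \<circ> q B)"
  proof (rule compact_op_limit)
    show "bounded_clinear (Ad T t \<circ> q B)"
      unfolding Ad_def S_def[symmetric] by (intro bounded_clinear_compose qc T tc S)
    fix \<delta> :: real assume "\<delta> > 0"
    obtain c where c: "c > 0" "\<And>x. norm (T (t x)) \<le> norm x * c"
      using bounded_linear.pos_bounded[OF bounded_clinear_linear[OF bounded_clinear_compose[OF T tc]]]
      by auto
    obtain A where A: "A \<in> \<AA>" "compact_op (t \<circ> p A)"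
      "\<And>x. norm (q B (T (p (X - A) x))) \<le> \<delta> / c * norm x"
      using cutoff[of "\<delta> / c"] c(1) \<open>\<delta> > 0\<close> by auto
    \<comment> \<open>On this side the cut-off stands next to \<open>S\<close>;
      \<open>p (X - A) \<circ> S \<circ> q B\<close> is the adjoint of the operator controlled by
      quasi-properness and inherits its bound.\<close>
    have adj: "norm (p (X - A) (S (q B x))) \<le> \<delta> / c * norm x" for x
    proof (rule adjoint_norm_le[OF _ A(3)])
      show "inner (q B (T (p (X - A) x))) y = inner x (p (X - A) (S (q B y)))" for x y
        using orth_projection_inner[OF projection, of "X - A"] A(1)
        by (simp add: orth_projection_inner[OF q] TS compl_sets)
    qed (use c(1) \<open>\<delta> > 0\<close> in simp)
    interpret R: bounded_linear "T \<circ> t"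
      by (intro bounded_clinear_linear bounded_clinear_compose tc T)
    have "compact_op (T \<circ> (t \<circ> p A) \<circ> (S \<circ> q B))"
      by (intro compact_op_compose_left compact_op_compose_right bounded_clinear_compose A qc T S)
    moreover have "norm ((Ad T t \<circ> q B) x - (T \<circ> (t \<circ> p A) \<circ> (S \<circ> q B)) x) \<le> \<delta>" if "norm x \<le> 1" for x
    proof -
      define b where "b = S (q B x)"
      have "(Ad T t \<circ> q B) x - (T \<circ> (t \<circ> p A) \<circ> (S \<circ> q B)) x = (T \<circ> t) (b - p A b)"
        unfolding R.diff by (simp add: Ad_def S_def b_def)
      also have "b - p A b = p (X - A) b"
        using p_compl[OF A(1), of b] by (simp add: algebra_simps)
      also have "norm ((T \<circ> t) (p (X - A) b)) \<le> norm (p (X - A) b) * c"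
        using c(2) by simp
      also have "\<dots> \<le> \<delta> / c * 1 * c"
        using c(1) \<open>\<delta> > 0\<close> that unfolding b_def
        by (intro mult_right_mono order_trans[OF adj] mult_left_mono) auto
      finally show ?thesis
        using c(1) by simp
    qed
    ultimately show "\<exists>g. compact_op g \<and> (\<forall>x. norm x \<le> 1 \<longrightarrow> norm ((Ad T t \<circ> q B) x - g x) \<le> \<delta>)"
      by blast
  qed
qed

end

text \<open>\<open>P\<close> decomposes vectors into components, while \<open>Q\<close> serves to
  separate families of pieces and to count those that a bounded set meets.\<close>

locale discrete_locally_finite_module = coarse_module X \<E> \<AA> p
  for X :: "'x set" and \<E> :: "('x \<times> 'x) set set" and \<AA> :: "'x set set"
    and p :: "'x set \<Rightarrow> 'h::complex_hilbert_space \<Rightarrow> 'h" +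
  fixes E :: "('x \<times> 'x) set" and P Q :: "'x set set"
  assumes conn: "coarsely_connected X \<E>"
    and entourage: "E \<in> \<E>"
    and discrete: "discrete_partition X \<E> \<AA> p P"
    and P_bounded: "C \<in> P \<Longrightarrow> ent_bounded E C"
    and loc_finite: "locally_finite_partition X \<E> Q"
    and Q_bounded: "D \<in> Q \<Longrightarrow> ent_bounded E D"
begin

lemma P_partition: "partition_on X P"
  and P_measurable: "C \<in> P \<Longrightarrow> C \<in> \<AA>"
  and P_has_sum: "((\<lambda>C. p C x) has_sum x) P"
  using discrete by (auto simp: discrete_partition_def)

lemma P_disjoint: "C \<in> P \<Longrightarrow> C' \<in> P \<Longrightarrow> C \<noteq> C' \<Longrightarrow> C \<inter> C' = {}"
  using partition_onD2[OF P_partition] by (auto simp: pairwise_def disjnt_def)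

lemma Union_P_Int:
  assumes "P' \<subseteq> P" "C \<in> P"
  shows "C \<inter> \<Union>P' = (if C \<in> P' then C else {})"
proof (cases "C \<in> P'")
  case False
  have "C \<inter> C' = {}" if "C' \<in> P'" for C'
    using that assms False by (intro P_disjoint) auto
  with False show ?thesis
    by auto
qed auto

text \<open>A union of pieces, even an infinite one, meets each piece in that piece or in the empty
  set, so the last clause of discreteness applies.\<close>

lemma Union_P_measurable:
  assumes "P' \<subseteq> P"
  shows "\<Union>P' \<in> \<AA>"
proof -
  have "\<Union>P' \<subseteq> X"
    using assms partition_onD1[OF P_partition] by blast
  moreover have "\<Union>P' \<inter> C \<in> \<AA>" if "C \<in> P" for C
    using Union_P_Int[OF assms that] P_measurable[OF that] by (simp add: Int_commute)
  ultimately show ?thesis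
    using discrete by (auto simp: discrete_partition_def)
qed

lemma p_Union_P:
  assumes "P' \<subseteq> P" "C \<in> P"
  shows "p C (p (\<Union>P') x) = (if C \<in> P' then p C x else 0)"
  by (simp add: p_p P_measurable Union_P_measurable assms Union_P_Int p_empty)

lemma Q_finite: "coarse_bounded \<E> A \<Longrightarrow> finite {D \<in> Q. D \<inter> A \<noteq> {}}"
  using loc_finite by (simp add: locally_finite_partition_def)

lemma Q_cover: "x \<in> X \<Longrightarrow> \<exists>D\<in>Q. x \<in> D"
  using loc_finite partition_onD1 by (fastforce simp: locally_finite_partition_def)

lemma partition_bounded: "C \<in> P \<or> C \<in> Q \<Longrightarrow> coarse_bounded \<E> C"
  using P_bounded Q_bounded entourage by (auto simp: coarse_bounded_def)

section \<open>Vectors escaping from bounded sets\<close>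

lemma escaping_step:
  fixes R :: "'h \<Rightarrow> 'k::real_normed_vector"
  assumes R: "bounded_linear R" and \<epsilon>: "\<epsilon> > 0"
    and bad: "\<And>A. A \<in> \<AA> \<Longrightarrow> coarse_bounded \<E> A \<Longrightarrow> \<epsilon> < onorm (R \<circ> p (X - A))"
    and G: "finite G" "G \<subseteq> P"
  shows "\<exists>F v. finite F \<and> F \<subseteq> P \<and> p (\<Union>F) v = v \<and> norm v \<le> 1 \<and> \<epsilon> < norm (R v) \<and>
    (\<forall>D\<in>Q. \<forall>C\<in>G. \<forall>C'\<in>F. D \<inter> C = {} \<or> D \<inter> C' = {})"
proof -
  interpret R: bounded_linear R by fact
  \<comment> \<open>\<open>U\<close> collects the pieces of \<open>Q\<close> that meet
    \<open>G\<close>, and \<open>A\<close> enlarges it to whole pieces of \<open>P\<close>. Both are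
    bounded, and a piece of \<open>P\<close> that misses \<open>U\<close> shares no piece of
    \<open>Q\<close> with \<open>G\<close>.\<close>
  define U where "U = \<Union>{D \<in> Q. D \<inter> \<Union>G \<noteq> {}}"
  define A where "A = \<Union>{C \<in> P. C \<inter> U \<noteq> {}}"
  have GB: "coarse_bounded \<E> (\<Union>G)"
    using G(2) by (intro coarse_bounded_finite_Union[OF conn G(1)] partition_bounded) blast
  have "coarse_bounded \<E> U"
    unfolding U_def
    by (intro coarse_bounded_finite_Union[OF conn Q_finite[OF GB]] partition_bounded) simp
  then have "coarse_bounded \<E> A"
    unfolding A_def by (intro coarse_bounded_star[OF entourage] P_bounded)
  moreover have A: "A \<in> \<AA>"
    unfolding A_def by (intro Union_P_measurable) auto
  ultimately have "\<epsilon> < onorm (R \<circ> p (X - A))"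
    by (intro bad)
  then obtain x where x: "\<epsilon> * norm x < norm (R (p (X - A) x))"
    using onorm_bound[of \<epsilon> "R \<circ> p (X - A)"] \<epsilon> by (auto simp: not_le[symmetric])
  interpret pXA: bounded_linear "p (X - A)"
    using A by (intro p_linear) auto
  have x0: "x \<noteq> 0"
    using x by (auto simp: pXA.zero R.zero)
  define w where "w = p (X - A) (x /\<^sub>R norm x)"
  have w1: "norm w \<le> 1"
    unfolding w_def using A x0
    by (intro order_trans[OF orth_projection_norm_le[OF projection]]) auto
  have Rw: "\<epsilon> < norm (R w)"
    using x x0 by (simp add: w_def pXA.scaleR R.scaleR field_simps)
  \<comment> \<open>Strong convergence over \<open>P\<close> lets finitely many components of
    \<open>w\<close> keep the strict bound.\<close>
  have "((\<lambda>C. R (p C w)) has_sum R w) P"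
    using has_sum_bounded_linear[OF R P_has_sum] .
  then have "((\<lambda>F. norm (\<Sum>C\<in>F. R (p C w))) \<longlongrightarrow> norm (R w)) (finite_subsets_at_top P)"
    unfolding has_sum_def by (rule tendsto_norm)
  from order_tendstoD(1)[OF this Rw] obtain F0
    where F0: "finite F0" "F0 \<subseteq> P" "\<epsilon> < norm (\<Sum>C\<in>F0. R (p C w))"
    unfolding eventually_finite_subsets_at_top by blast
  \<comment> \<open>The discarded pieces lie in \<open>A\<close>, where \<open>w\<close> has no
    component, so discarding them leaves the sum unchanged.\<close>
  define F where "F = {C \<in> F0. C \<inter> U = {}}"
  have F: "finite F" "F \<subseteq> P"
    using F0 by (auto simp: F_def)
  have FA: "\<Union>F \<in> \<AA>"
    by (rule Union_P_measurable[OF F(2)])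
  have "p C w = 0" if "C \<in> F0 - F" for C
  proof -
    have C: "C \<in> P" "C \<subseteq> A"
      using that F0(2) by (auto simp: F_def A_def)
    then have "p C w = p (C \<inter> (X - A)) (x /\<^sub>R norm x)"
      using A P_measurable by (simp add: w_def p_p compl_sets)
    also have "C \<inter> (X - A) = {}"
      using C by blast
    finally show ?thesis
      by (simp add: p_empty)
  qed
  then have "(\<Sum>C\<in>F0. R (p C w)) = (\<Sum>C\<in>F. R (p C w))"
    using F0(1) by (intro sum.mono_neutral_right) (auto simp: F_def R.zero)
  also have "\<dots> = R (p (\<Union>F) w)"
    using F P_measurable pairwise_subset[OF partition_onD2[OF P_partition] F(2)]
    by (subst p_finite_Union) (auto simp: R.sum)
  finally have "\<epsilon> < norm (R (p (\<Union>F) w))"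
    using F0(3) by simp
  moreover have "norm (p (\<Union>F) w) \<le> 1"
    using order_trans[OF orth_projection_norm_le[OF projection[OF FA]] w1] .
  moreover have "p (\<Union>F) (p (\<Union>F) w) = p (\<Union>F) w"
    by (simp add: p_p FA)
  moreover have "\<forall>D\<in>Q. \<forall>C\<in>G. \<forall>C'\<in>F. D \<inter> C = {} \<or> D \<inter> C' = {}"
    by (auto simp: F_def U_def)
  ultimately show ?thesis
    using F by blast
qed

text \<open>Iterating \<open>escaping_step\<close> with \<open>G\<close> the union of all families
  chosen so far separates each new family from every earlier one.\<close>

lemma escaping_sequence:
  fixes R :: "'h \<Rightarrow> 'k::real_normed_vector"
  assumes R: "bounded_linear R" and \<epsilon>: "\<epsilon> > 0"
    and bad: "\<And>A. A \<in> \<AA> \<Longrightarrow> coarse_bounded \<E> A \<Longrightarrow> \<epsilon> < onorm (R \<circ> p (X - A))"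
  obtains F v where "\<And>n. finite (F n)" "\<And>n. F n \<subseteq> P" "\<And>n. p (\<Union>(F n)) (v n) = v n"
    "\<And>n. norm (v n) \<le> 1" "\<And>n::nat. \<epsilon> < norm (R (v n))"
    "\<forall>m n. m < n \<longrightarrow> (\<forall>D\<in>Q. \<forall>C\<in>F m. \<forall>C'\<in>F n. D \<inter> C = {} \<or> D \<inter> C' = {})"
proof -
  obtain f w where fw: "\<And>G. finite G \<Longrightarrow> G \<subseteq> P \<Longrightarrow> finite (f G) \<and> f G \<subseteq> P \<and> p (\<Union>(f G)) (w G) = w G \<and>
      norm (w G) \<le> 1 \<and> \<epsilon> < norm (R (w G)) \<and> (\<forall>D\<in>Q. \<forall>C\<in>G. \<forall>C'\<in>f G. D \<inter> C = {} \<or> D \<inter> C' = {})"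
    using escaping_step[OF R \<epsilon> bad] by metis
  define g where "g n = ((\<lambda>G. G \<union> f G) ^^ n) {}" for n
  have g: "finite (g n) \<and> g n \<subseteq> P" for n
    by (induction n) (use fw in \<open>auto simp: g_def\<close>)
  have Suc: "g (Suc n) = g n \<union> f (g n)" for n
    by (simp add: g_def)
  have mono: "f (g m) \<subseteq> g n" if "m < n" for m n
    using lift_Suc_mono_le[of g "Suc m" n] that Suc by (metis Suc_leI Un_subset_iff sup_ge1)
  show ?thesis
  proof (rule that[of "\<lambda>n. f (g n)" "\<lambda>n. w (g n)"])
    show "\<forall>m n. m < n \<longrightarrow> (\<forall>D\<in>Q. \<forall>C\<in>f (g m). \<forall>C'\<in>f (g n). D \<inter> C = {} \<or> D \<inter> C' = {})"
      using fw[OF conjunct1[OF g] conjunct2[OF g]] mono by blast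
  qed (use fw g in simp_all)
qed

section \<open>The block diagonal projection\<close>

lemma escaping_projection:
  assumes F: "\<And>n. finite (F n)" "\<And>n::nat. F n \<subseteq> P"
    and v: "\<And>n. p (\<Union>(F n)) (v n) = v n"
    and sep: "\<forall>m n. m < n \<longrightarrow> (\<forall>D\<in>Q. \<forall>C\<in>F m. \<forall>C'\<in>F n. D \<inter> C = {} \<or> D \<inter> C' = {})"
  shows "\<exists>t. orth_projection t \<and> t \<in> Prop \<AA> p E \<and> t \<in> locally_compact_ops \<E> \<AA> p \<and>
    (\<forall>n. t (v n) = v n) \<and> (\<forall>m n. m \<noteq> n \<longrightarrow> inner (v m) (v n) = 0)"
proof -
  \<comment> \<open>A piece is nonempty and hence meets some \<open>D\<close> in \<open>Q\<close>;
    if it belonged to two families, \<open>D\<close> would meet both.\<close>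
  have disj: "m = n" if "C \<in> F m" "C \<in> F n" for m n C
  proof -
    have "C \<noteq> {}" "C \<subseteq> X"
      using that F(2) P_partition by (auto simp: partition_on_def)
    then obtain D where "D \<in> Q" "D \<inter> C \<noteq> {}"
      using Q_cover by blast
    then show ?thesis
      using sep that by (meson linorder_neqE_nat)
  qed
  \<comment> \<open>By \<open>disj\<close> the index is unique. The default \<open>0\<close> makes
    the line projection vanish, so membership in \<open>W\<close> forces the components outside all
    families to be \<open>0\<close>.\<close>
  define u where "u C = (if C \<in> \<Union>(range F) then p C (v (THE n. C \<in> F n)) else 0)" for C
  have u: "u C = p C (v n)" if "C \<in> F n" for C n
  proof -
    have "(THE n. C \<in> F n) = n"
      using that disj by blast
    with that show ?thesis
      by (auto simp: u_def)
  qed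
  have u0: "u C = 0" if "C \<notin> \<Union>(range F)" for C
    using that by (simp add: u_def)
  have L: "bounded_clinear (line_projection (u C) \<circ> p C)" if "C \<in> P" for C
    using that by (intro bounded_clinear_compose bounded_clinear_line_projection p_clinear P_measurable)
  define W where "W = (\<Inter>C\<in>P. {x. p C x = (line_projection (u C) \<circ> p C) x})"
  have WI: "x \<in> W" if "\<And>C. C \<in> P \<Longrightarrow> p C x = line_projection (u C) (p C x)" for x
    using that by (simp add: W_def)
  have "subspace W"
    unfolding W_def
  proof (intro subspace_Inter ballI, clarify)
    fix C assume C: "C \<in> P"
    interpret a: bounded_linear "p C"
      by (intro p_linear P_measurable C)
    interpret b: bounded_linear "line_projection (u C) \<circ> p C"
      by (intro bounded_clinear_linear L C)
    show "subspace {x. p C x = (line_projection (u C) \<circ> p C) x}"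
      unfolding subspace_def mem_Collect_eq
      by (simp add: a.zero b.zero a.add b.add a.scaleR b.scaleR del: comp_apply)
  qed
  moreover have "closed W"
    unfolding W_def
    by (intro closed_INT ballI closed_Collect_eq linear_continuous_on bounded_clinear_linear L
        p_clinear P_measurable)
  moreover have "scaleC a x \<in> W" if "x \<in> W" for a x
    using that bounded_clinear_scaleC[OF L] bounded_clinear_scaleC[OF p_clinear[OF P_measurable]]
    by (simp add: W_def)
  ultimately obtain t where t: "orth_projection t" "\<And>x. t x \<in> W" "\<And>x. x \<in> W \<Longrightarrow> t x = x"
    using orth_projection_onto by blast
  have tc: "bounded_clinear t"
    by (rule orth_projection_clinear[OF t(1)])
  have ptx: "p C (t x) = line_projection (u C) (p C (t x))" if "C \<in> P" for C x
    using t(2)[of x] that by (simp add: W_def)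
  have ptx0: "p C (t x) = 0" if "C \<in> P" "C \<notin> \<Union>(range F)" for C x
    using ptx[OF that(1), of x] u0[OF that(2)] by (simp add: line_projection_def)
  \<comment> \<open>Cutting to a union of pieces keeps or erases each component, and both respect
    the condition defining \<open>W\<close>.\<close>
  have comm: "t (p (\<Union>P') x) = p (\<Union>P') (t x)" if P': "P' \<subseteq> P" for P' x
  proof (rule orth_projection_commute[OF t(1,3,2)])
    show "orth_projection (p (\<Union>P'))"
      by (intro projection Union_P_measurable P')
    show "p (\<Union>P') y \<in> W" if "y \<in> W" for y
    proof (rule WI)
      show "p C (p (\<Union>P') y) = line_projection (u C) (p C (p (\<Union>P') y))" if "C \<in> P" for C
        using \<open>y \<in> W\<close> that by (auto simp: p_Union_P[OF P' that] W_def line_projection_def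
            linear_0[OF bounded_linear.linear[OF bounded_linear_cinner]])
    qed
  qed
  \<comment> \<open>A measurable \<open>A\<close> may cut through pieces, and then
    \<open>p A\<close> need not commute with \<open>t\<close>; the union of all pieces meeting
    \<open>A\<close> takes its place.\<close>
  define star where "star A = {C \<in> P. C \<inter> A \<noteq> {}}" for A
  have star: "star A \<subseteq> P" for A
    by (auto simp: star_def)
  have starA: "\<Union>(star A) \<in> \<AA>" for A
    by (intro Union_P_measurable star)
  have p_star: "p A (p (\<Union>(star A)) x) = p A x" "p (\<Union>(star A)) (p A x) = p A x" if "A \<in> \<AA>" for A x
  proof -
    have "A \<subseteq> \<Union>(star A)"
      using sets_into_space[OF that] partition_onD1[OF P_partition] by (auto simp: star_def)
    then have "A \<inter> \<Union>(star A) = A" "\<Union>(star A) \<inter> A = A"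
      by auto
    then show "p A (p (\<Union>(star A)) x) = p A x" "p (\<Union>(star A)) (p A x) = p A x"
      by (simp_all add: p_p that starA)
  qed
  have "t \<in> Prop \<AA> p E"
    unfolding Prop_def
  proof (intro CollectI conjI ballI impI tc ext)
    fix A A' x assume A: "A \<in> \<AA>" "A' \<in> \<AA>" "A' \<inter> thickening E A = {}"
    \<comment> \<open>A point of \<open>A'\<close> in a piece meeting \<open>A\<close> would lie in
      the \<open>E\<close>-neighbourhood of \<open>A\<close>, as pieces are
      \<open>E\<close>-bounded.\<close>
    have "A' \<inter> \<Union>(star A) = {}"
      using A(3) P_bounded by (fastforce simp: star_def thickening_def ent_bounded_def)
    then have "p A' (p (\<Union>(star A)) y) = 0" for y
      by (simp add: p_p A starA p_empty)
    then show "(p A' \<circ> t \<circ> p A) x = 0"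
      using comm[OF star] p_star(2)[OF A(1)] by (metis comp_apply)
  qed
  moreover have "t \<in> locally_compact_ops \<E> \<AA> p"
    unfolding locally_compact_ops_def
  proof (intro CollectI conjI ballI impI tc)
    fix A assume A: "A \<in> \<AA>" "coarse_bounded \<E> A"
    \<comment> \<open>\<open>N\<close> is the set of stages whose family meets \<open>A\<close>.
      Each is assigned a piece of \<open>Q\<close> meeting both \<open>A\<close> and that family;
      \<open>sep\<close> makes this choice injective and local finiteness makes \<open>N\<close>
      finite.\<close>
    define N where "N = {n. \<exists>C\<in>F n. C \<inter> A \<noteq> {}}"
    define G where "G = star A \<inter> \<Union>(range F)"
    have "\<exists>D\<in>Q. D \<inter> A \<noteq> {} \<and> (\<exists>C\<in>F n. D \<inter> C \<noteq> {})" if n: "n \<in> N" for n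
    proof -
      obtain C x where "C \<in> F n" "x \<in> C" "x \<in> A"
        using n unfolding N_def by blast
      moreover obtain D where "D \<in> Q" "x \<in> D"
        using Q_cover \<open>x \<in> A\<close> A(1) sets_into_space by blast
      ultimately show ?thesis
        by blast
    qed
    then obtain D where D: "\<And>n. n \<in> N \<Longrightarrow> D n \<in> Q" "\<And>n. n \<in> N \<Longrightarrow> D n \<inter> A \<noteq> {}"
      "\<And>n. n \<in> N \<Longrightarrow> \<exists>C\<in>F n. D n \<inter> C \<noteq> {}"
      by metis
    have "inj_on D N"
    proof (rule linorder_inj_onI)
      fix m n assume mn: "m < n" "m \<in> N" "n \<in> N"
      then obtain C C' where "C \<in> F m" "D m \<inter> C \<noteq> {}" "C' \<in> F n" "D n \<inter> C' \<noteq> {}"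
        using D(3) by meson
      then show "D m \<noteq> D n"
        using sep mn(1) D(1)[OF mn(2)] by metis
    qed auto
    then have "finite N"
      by (rule inj_on_finite[OF _ _ Q_finite[OF A(2)]]) (use D in auto)
    moreover have "G \<subseteq> (\<Union>n\<in>N. F n)"
      by (auto simp: G_def N_def star_def)
    ultimately have G: "finite G"
      using F(1) by (meson finite_UN_I finite_subset)
    have cut: "p (\<Union>(star A)) (t x) = (\<Sum>C\<in>G. p C (t x))" for x
    proof -
      have "((\<lambda>C. p C (p (\<Union>(star A)) (t x))) has_sum p (\<Union>(star A)) (t x)) P"
        by (rule P_has_sum)
      also have "?this \<longleftrightarrow> ((\<lambda>C. p C (t x)) has_sum p (\<Union>(star A)) (t x)) G"
        using star ptx0 by (intro has_sum_cong_neutral) (auto simp: G_def p_Union_P)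
      finally show ?thesis
        using has_sum_finite[OF G] has_sum_unique by blast
    qed
    have "compact_op (\<lambda>x. \<Sum>C\<in>G. p C (t x))"
    proof (rule compact_op_sum[OF G])
      fix C assume "C \<in> G"
      then have C: "C \<in> P"
        by (auto simp: G_def star_def)
      \<comment> \<open>Each block of \<open>t\<close> takes values in the line through
        \<open>u C\<close>, so the finite sum over \<open>G\<close> is compact.\<close>
      have "compact_op (line_projection (u C) \<circ> (p C \<circ> t))"
        by (intro compact_op_compose_right compact_op_line_projection bounded_clinear_compose
            p_clinear P_measurable C tc)
      also have "line_projection (u C) \<circ> (p C \<circ> t) = (\<lambda>x. p C (t x))"
        using ptx[OF C] by (simp add: fun_eq_iff)
      finally show "compact_op (\<lambda>x. p C (t x))" .
    qed
    then have K: "compact_op (p (\<Union>(star A)) \<circ> t)"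
      by (simp add: cut o_def)
    have "p A \<circ> t = p A \<circ> (p (\<Union>(star A)) \<circ> t)"
      by (simp add: fun_eq_iff p_star A(1))
    then show "compact_op (p A \<circ> t)"
      using compact_op_compose_left[OF p_clinear[OF A(1)] K] by simp
    \<comment> \<open>Commutation with the star moves the cut-off past \<open>t\<close>, so the same
      compact operator \<open>K\<close> handles both sides.\<close>
    have "t \<circ> p A = (p (\<Union>(star A)) \<circ> t) \<circ> p A"
      by (simp add: fun_eq_iff p_star A(1) flip: comm[OF star])
    then show "compact_op (t \<circ> p A)"
      using compact_op_compose_right[OF K p_clinear[OF A(1)]] by simp
  qed
  moreover have "t (v n) = v n" for n
  proof (intro t(3) WI)
    fix C assume C: "C \<in> P"
    show "p C (v n) = line_projection (u C) (p C (v n))"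
    proof (cases "C \<in> F n")
      case True
      then show ?thesis
        using line_projection_self[of "u C"] by (simp add: u)
    next
      case False
      then have "p C (v n) = 0"
        using p_Union_P[OF F(2)[of n] C, of "v n"] by (simp add: v)
      then show ?thesis
        by (simp add: linear_0[OF bounded_linear.linear[OF bounded_clinear_linear[OF bounded_clinear_line_projection]]])
    qed
  qed
  moreover have "inner (v m) (v n) = 0" if "m \<noteq> n" for m n
  proof -
    have FA: "\<Union>(F k) \<in> \<AA>" for k
      by (intro Union_P_measurable F)
    have "C \<inter> C' = {}" if "C \<in> F m" "C' \<in> F n" for C C'
      using that F(2) P_disjoint[of C C'] disj[of C m n] \<open>m \<noteq> n\<close> by blast
    then have "\<Union>(F m) \<inter> \<Union>(F n) = {}"
      by blast
    then have "p (\<Union>(F m)) (v n) = 0"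
      using p_p[OF FA FA, of m n "v n"] by (simp add: v p_empty)
    then show ?thesis
      using orth_projection_inner[OF projection[OF FA[of m]], of "v m" "v n"] by (simp add: v)
  qed
  ultimately show ?thesis
    using t(1) by blast
qed

text \<open>Failure of quasi-properness at \<open>B\<close> and \<open>\<epsilon>\<close> is the
  hypothesis of \<open>escaping_sequence\<close> for \<open>q B \<circ> T\<close>; the resulting
  projection lies in the domain of condition (iii), but its image is not locally compact at
  \<open>B\<close>.\<close>

lemma quasi_properI:
  fixes q :: "'y set \<Rightarrow> 'k::complex_hilbert_space \<Rightarrow> 'k"
  assumes T: "bounded_clinear T" and q: "\<And>B. B \<in> \<BB> \<Longrightarrow> orth_projection (q B)"
    and Ad: "Ad T ` (Prop \<AA> p E \<inter> locally_compact_ops \<E> \<AA> p) \<subseteq> locally_compact_ops \<F> \<BB> q"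
  shows "quasi_proper X \<E> \<AA> p \<F> \<BB> q T"
proof (rule ccontr)
  assume "\<not> ?thesis"
  then obtain B \<epsilon> where B: "B \<in> \<BB>" "coarse_bounded \<F> B" and \<epsilon>: "\<epsilon> > 0"
    and bad: "\<And>A. A \<in> \<AA> \<Longrightarrow> coarse_bounded \<E> A \<Longrightarrow> \<epsilon> < onorm (q B \<circ> T \<circ> p (X - A))"
    unfolding quasi_proper_def by (auto simp: not_le)
  have R: "bounded_linear (q B \<circ> T)"
    by (intro bounded_clinear_linear bounded_clinear_compose T orth_projection_clinear q B)
  obtain F v where F: "\<And>n. finite (F n)" "\<And>n. F n \<subseteq> P" "\<And>n. p (\<Union>(F n)) (v n) = v n"
    "\<forall>m n. m < n \<longrightarrow> (\<forall>D\<in>Q. \<forall>C\<in>F m. \<forall>C'\<in>F n. D \<inter> C = {} \<or> D \<inter> C' = {})"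
    and v: "\<And>n. norm (v n) \<le> 1" "\<And>n::nat. \<epsilon> < norm ((q B \<circ> T) (v n))"
    using escaping_sequence[OF R \<epsilon> bad] by metis
  obtain t where t: "orth_projection t" "t \<in> Prop \<AA> p E" "t \<in> locally_compact_ops \<E> \<AA> p"
    "\<And>n. t (v n) = v n" "\<And>m n. m \<noteq> n \<Longrightarrow> inner (v m) (v n) = 0"
    using escaping_projection[of F v, OF F] by blast
  have "Ad T t \<in> locally_compact_ops \<F> \<BB> q"
    using Ad t(2,3) by blast
  then have "compact_op (q B \<circ> Ad T t)"
    using B by (simp add: locally_compact_ops_def)
  moreover have "\<not> compact_op (q B \<circ> Ad T t)"
    using v by (intro not_compact_op_Ad[OF T q[OF B(1)] t(1,4,5) _ _ \<epsilon>]) auto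
  ultimately show False
    by blast
qed

end

section \<open>Equivalence of the three conditions\<close>

theorem theorem1p4:
  fixes X :: "'x set" and \<E> :: "('x \<times> 'x) set set" and \<AA> :: "'x set set"
    and Y :: "'y set" and \<F> :: "('y \<times> 'y) set set" and \<BB> :: "'y set set"
    and p :: "'x set \<Rightarrow> 'h::complex_hilbert_space \<Rightarrow> 'h"
    and q :: "'y set \<Rightarrow> 'k::complex_hilbert_space \<Rightarrow> 'k"
    and T :: "'h \<Rightarrow> 'k"
    and E :: "('x \<times> 'x) set"
  assumes "coarse_module X \<E> \<AA> p"
    and "coarse_module Y \<F> \<BB> q"
    and "coarsely_connected X \<E>"
    and "bounded_clinear T"
    and "coarse_gauge X \<E> E"
  defines "cond_i \<equiv> quasi_proper X \<E> \<AA> p \<F> \<BB> q T"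
    and "cond_ii \<equiv> Ad T ` locally_compact_ops \<E> \<AA> p \<subseteq> locally_compact_ops \<F> \<BB> q"
    and "cond_iii \<equiv> Ad T ` (Prop \<AA> p E \<inter> locally_compact_ops \<E> \<AA> p) \<subseteq> locally_compact_ops \<F> \<BB> q"
  shows "(cond_i \<longrightarrow> cond_ii) \<and> (cond_ii \<longrightarrow> cond_iii) \<and>
    (discrete_module X \<E> \<AA> p \<and> coarsely_locally_finite X \<E> \<and>
     witnesses_discreteness X \<E> \<AA> p E \<and> witnesses_local_finiteness X \<E> E \<longrightarrow>
       (cond_iii \<longrightarrow> cond_i) \<and> (cond_i \<longleftrightarrow> cond_ii) \<and> (cond_ii \<longleftrightarrow> cond_iii))"
proof -
  interpret X: coarse_module X \<E> \<AA> p by fact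
  interpret Y: coarse_module Y \<F> \<BB> q by fact
  have i_ii: "cond_ii" if "cond_i"
    unfolding cond_ii_def
  proof clarify
    fix t assume t: "t \<in> locally_compact_ops \<E> \<AA> p"
    then have "bounded_clinear (Ad T t)"
      unfolding Ad_def using assms(4)
      by (intro bounded_clinear_compose bounded_clinear_cadjoint) (auto simp: locally_compact_ops_def)
    moreover have "compact_op (Ad T t \<circ> q B)" "compact_op (q B \<circ> Ad T t)"
      if "B \<in> \<BB>" "coarse_bounded \<F> B" for B
      using X.quasi_proper_compact[OF \<open>cond_i\<close>[unfolded cond_i_def] assms(4) t that Y.projection] that
      by auto
    ultimately show "Ad T t \<in> locally_compact_ops \<F> \<BB> q"
      by (simp add: locally_compact_ops_def)
  qed
  have ii_iii: "cond_iii" if "cond_ii"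
    using that by (auto simp: cond_ii_def cond_iii_def)
  have iii_i: "cond_i" if wit: "witnesses_discreteness X \<E> \<AA> p E" "witnesses_local_finiteness X \<E> E" "cond_iii"
  proof -
    obtain P where P: "discrete_partition X \<E> \<AA> p P" "\<And>C. C \<in> P \<Longrightarrow> ent_bounded E C"
      using wit(1) by (auto simp: witnesses_discreteness_def)
    obtain Q where Q: "locally_finite_partition X \<E> Q" "\<And>C. C \<in> Q \<Longrightarrow> ent_bounded E C"
      using wit(2) by (auto simp: witnesses_local_finiteness_def)
    interpret discrete_locally_finite_module X \<E> \<AA> p E P Q
      using assms(3,5) P Q by unfold_locales (auto simp: coarse_gauge_def)
    show ?thesis
      using wit(3) unfolding cond_i_def cond_iii_def by (intro quasi_properI assms(4) Y.projection)
  qed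
  show ?thesis
    using i_ii ii_iii iii_i by blast
qed

end
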